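(* Let $n\geq 1$, let $G$ be a (not necessarily planar) simple graph with $n$ vertices, $m$ edges and maximum degree $d\geq 4$, and let $k$ be an integer with $3\leq k\leq d-1$. Then there exists a set $\mathcal I\subseteq V(G)$ such that $G[\mathcal I]$ has maximum degree at most $k$ and: (1) if $d=4$ and $k=3$, then $|\mathcal I|\geq \frac{7}{11}n-\frac{24}{11}$; (2) if $d=5$ and $k=3$, then $|\mathcal I|\geq \frac{35}{78}n-\frac{8}{13}$; (3) if $d\geq 6$ and $k=3$, then $|\mathcal I|\geq \frac{10}{13}n-\frac{5}{39}m-\frac{8}{13}$; (4) if $d=5$ and $k=4$, then $|\mathcal I|\geq \frac{9}{14}n-\frac{1}{2}$; (5) if $d\geq 6$ and $k=4$, then $|\mathcal I|\geq \frac{54}{59}n-\frac{9}{59}m-\frac{35}{59}$; (6) if $d\geq 6$ and $k\geq 5$, then $|\mathcal I|\geq n-\frac{m}{k+1}$.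
   Context: $G[\mathcal I]$ denotes the subgraph of $G$ induced by $\mathcal I$; the degree of a graph is its maximum vertex degree. *)

theory Defs
  imports Complex_Main
begin

definition simple_graph :: "'a set \<Rightarrow> 'a set set \<Rightarrow> bool" where
  "simple_graph V E \<longleftrightarrow> finite V \<and> (\<forall>e\<in>E. e \<subseteq> V \<and> card e = 2)"

definition vertex_degree :: "'a set set \<Rightarrow> 'a \<Rightarrow> nat" where
  "vertex_degree E v = card {e \<in> E. v \<in> e}"

(* The inserted 0 only matters for the graph without vertices, whose maximum degree is
   taken to be 0. *)
definition max_degree :: "'a set \<Rightarrow> 'a set set \<Rightarrow> nat" where
  "max_degree V E = Max (insert 0 (vertex_degree E ` V))"

(* For I \<subseteq> V, the subgraph of (V, E) induced by I is (I, induced_edges E I). *)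
definition induced_edges :: "'a set set \<Rightarrow> 'a set \<Rightarrow> 'a set set" where
  "induced_edges E I = {e \<in> E. e \<subseteq> I}"

end

theory Submission
  imports Defs
begin

text \<open>
  Deleting \<open>D\<close> from a graph of maximum degree at most \<open>\<Delta>\<close> leaves maximum degree at most
  \<open>\<Delta> - 1\<close> as soon as \<open>D\<close> dominates the vertices of degree \<open>\<Delta>\<close>. For \<open>\<Delta> = 4\<close> and
  \<open>\<Delta> = 5\<close> a potential argument yields such a \<open>D\<close> with at most \<open>4n/11\<close> and \<open>5n/14\<close> vertices:
  an undominated vertex has a constant weight, any other vertex a weight depending on its number of
  undominated neighbours, and there is always a set \<open>S\<close> of vertices whose choice lowers the total
  weight by a fixed multiple of \<open>card S\<close>.

  Repeatedly deleting a vertex of degree greater than \<open>k\<close> costs at most \<open>m/(k + 1)\<close> vertices. The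
  bounds that involve both \<open>n\<close> and \<open>m\<close> are convex combinations of this greedy bound and the
  domination bounds, applied after the vertices of large degree have been deleted greedily.
\<close>

section \<open>Domination by a potential function\<close>

text \<open>The assumptions range over the whole type: for \<open>v\<close> outside
  \<open>V\<close>, symmetry and \<open>N_subset\<close> force \<open>N v\<close> to be
  empty.\<close>

locale bounded_degree_graph =
  fixes V :: "'a set" and N :: "'a \<Rightarrow> 'a set" and \<Delta> :: nat
  assumes finite_V: "finite V"
    and N_subset: "N v \<subseteq> V"
    and N_sym: "u \<in> N v \<Longrightarrow> v \<in> N u"
    and N_irrefl: "v \<notin> N v"
    and card_N_le: "card (N v) \<le> \<Delta>"
    and \<Delta>_pos: "\<Delta> > 0"
begin

definition dg :: "'a set \<Rightarrow> 'a \<Rightarrow> nat" where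
  "dg W v = card (N v \<inter> W)"

text \<open>The closed neighbourhood of \<open>S\<close>; thus \<open>W \<subseteq> reach D\<close>
  expresses that \<open>D\<close> dominates \<open>W\<close>.\<close>

definition reach :: "'a set \<Rightarrow> 'a set" where
  "reach S = S \<union> (\<Union>s\<in>S. N s)"

definition full :: "'a set" where
  "full = {v \<in> V. card (N v) = \<Delta>}"

text \<open>
  A state is the set of vertices of degree \<open>\<Delta>\<close> that are not yet dominated. A vertex outside it has
  smaller degree, has been chosen, or has a chosen neighbour; this gives the second conjunct.
\<close>
definition state :: "'a set \<Rightarrow> bool" where
  "state W \<longleftrightarrow> W \<subseteq> full \<and> (\<forall>y\<in>V - W. dg W y < \<Delta>)"

definition pot :: "int \<Rightarrow> (nat \<Rightarrow> int) \<Rightarrow> 'a set \<Rightarrow> int" where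
  "pot a f W = a * int (card W) + (\<Sum>y\<in>V - W. f (dg W y))"

lemma finite_N [simp]: "finite (N v)"
  using N_subset finite_V finite_subset by blast

lemma N_commute: "u \<in> N v \<longleftrightarrow> v \<in> N u"
  using N_sym by blast

lemma full_subset: "full \<subseteq> V"
  by (auto simp: full_def)

lemma state_subset: "state W \<Longrightarrow> W \<subseteq> V"
  using full_subset by (auto simp: state_def)

lemma state_dg_less: "state W \<Longrightarrow> y \<in> V - W \<Longrightarrow> dg W y < \<Delta>"
  by (simp add: state_def)

lemma state_finite: "state W \<Longrightarrow> finite W"
  using state_subset finite_V finite_subset by blast

lemma dg_mono: "W' \<subseteq> W \<Longrightarrow> dg W' v \<le> dg W v"
  unfolding dg_def by (rule card_mono) auto

lemma dg_less:
  assumes "u \<in> N v" "u \<in> W" "u \<notin> W'" "W' \<subseteq> W"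
  shows "dg W' v < dg W v"
  unfolding dg_def using assms by (intro psubset_card_mono) auto

lemma dg_le: "dg W v \<le> \<Delta>"
proof -
  have "dg W v \<le> card (N v)" unfolding dg_def by (rule card_mono) auto
  then show ?thesis using card_N_le[of v] by simp
qed

lemma dg_eq_0: "N v \<inter> W = {} \<Longrightarrow> dg W v = 0"
  by (simp add: dg_def)

lemma dg_eq_0_iff: "dg W v = 0 \<longleftrightarrow> N v \<inter> W = {}"
  by (simp add: dg_def)

lemma dg_outside:
  assumes "state W" "w \<in> W"
  shows "card (N w - W) + dg W w = \<Delta>"
proof -
  have "card (N w) = card (N w - W) + card (N w \<inter> W)"
    by (subst card_Un_disjoint[symmetric]) (auto simp: Un_Diff_Int)
  moreover have "card (N w) = \<Delta>" using assms by (auto simp: state_def full_def)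
  ultimately show ?thesis by (simp add: dg_def)
qed

text \<open>Both sums count the adjacent pairs with first member in \<open>A\<close> and second
  member in \<open>B\<close>.\<close>

lemma double_count:
  assumes "finite A" "finite B"
  shows "(\<Sum>y\<in>A. int (dg B y)) = (\<Sum>r\<in>B. int (dg A r))"
proof -
  have *: "int (dg C y) = (\<Sum>r\<in>C. if r \<in> N y then 1 else 0)" if "finite C" for C y
  proof -
    have "(\<Sum>r\<in>C. if r \<in> N y then 1 else 0) = (\<Sum>r\<in>C \<inter> N y. (1 :: int))"
      using that by (rule sum.inter_restrict[symmetric])
    then show ?thesis by (simp add: dg_def Int_commute)
  qed
  show ?thesis
    unfolding *[OF assms(1)] *[OF assms(2)]
    by (subst sum.swap) (simp add: N_commute)
qed

text \<open>
  In the weight of a vertex outside \<open>W\<close>, each lost neighbour counts for the slope \<open>\<delta>\<close>; the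
  vertices in \<open>Y\<close> lose all their neighbours and hence release their full weight.
\<close>
lemma pot_drop:
  assumes W: "state W" and R: "R \<subseteq> W"
    and slope: "\<And>i j. i \<le> j \<Longrightarrow> j \<le> M \<Longrightarrow> f i + \<delta> * (int j - int i) \<le> f j"
    and M: "\<And>y. y \<in> V - W \<Longrightarrow> dg W y \<le> M"
    and f0: "f 0 = 0"
    and Y: "Y \<subseteq> V - W" "\<And>y. y \<in> Y \<Longrightarrow> N y \<inter> W \<subseteq> R"
  shows "pot a f W - pot a f (W - R) \<ge>
    (\<Sum>r\<in>R. a + \<delta> * (int \<Delta> - int (dg W r)) - f (dg (W - R) r))
    + (\<Sum>y\<in>Y. f (dg W y) - \<delta> * int (dg W y))"
proof -
  have fin: "finite W" "finite R" "finite (V - W)" "finite Y"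
    using state_finite[OF W] R Y(1) finite_V by (auto intro: finite_subset)
  \<comment> \<open>The vertices of \<open>R\<close> join the outside: they give up the weight
    \<open>a\<close> but take on a weight \<open>f\<close> of their own.\<close>
  have split: "V - (W - R) = (V - W) \<union> R"
    using R state_subset[OF W] by auto
  have dgW: "dg W y = dg (W - R) y + dg R y" for y
  proof -
    have "N y \<inter> W = (N y \<inter> (W - R)) \<union> (N y \<inter> R)" using R by auto
    then show ?thesis unfolding dg_def
      by (simp only:) (rule card_Un_disjoint, auto)
  qed
  have point: "f (dg W y) - f (dg (W - R) y) \<ge> \<delta> * int (dg R y)
      + (if y \<in> Y then f (dg W y) - \<delta> * int (dg W y) else 0)" if "y \<in> V - W" for y
  proof (cases "y \<in> Y")
    case True
    then have "dg (W - R) y = 0" using Y(2)[OF True] by (intro dg_eq_0) auto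
    then show ?thesis using True dgW[of y] f0 by simp
  next
    case False
    then show ?thesis using slope[OF _ M[OF that], of "dg (W - R) y"] dgW[of y] by simp
  qed
  have "(\<Sum>y\<in>V - W. f (dg W y) - f (dg (W - R) y)) \<ge>
     (\<Sum>y\<in>V - W. \<delta> * int (dg R y)
      + (if y \<in> Y then f (dg W y) - \<delta> * int (dg W y) else 0))"
    by (intro sum_mono point)
  also have "(\<Sum>y\<in>V - W. \<delta> * int (dg R y)
      + (if y \<in> Y then f (dg W y) - \<delta> * int (dg W y) else 0)) =
    \<delta> * (\<Sum>y\<in>V - W. int (dg R y)) + (\<Sum>y\<in>Y. f (dg W y) - \<delta> * int (dg W y))"
    using fin Y(1) by (simp add: sum.distrib sum_distrib_left sum.If_cases Int_absorb1)
  \<comment> \<open>The losses of the outside vertices are counted from the side of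
    \<open>R\<close>, whose vertices have degree exactly \<Delta> and hence \<Delta> -
    \<open>dg W r\<close> neighbours outside \<open>W\<close>.\<close>
  also have "(\<Sum>y\<in>V - W. int (dg R y)) = (\<Sum>r\<in>R. int (dg (V - W) r))"
    using fin by (intro double_count) auto
  also have "\<dots> = (\<Sum>r\<in>R. int \<Delta> - int (dg W r))"
  proof (rule sum.cong)
    fix r assume "r \<in> R"
    have "N r \<inter> (V - W) = N r - W" using N_subset[of r] by auto
    then show "int (dg (V - W) r) = int \<Delta> - int (dg W r)"
      using dg_outside[OF W, of r] R \<open>r \<in> R\<close> by (auto simp: dg_def[of "V - W"])
  qed simp
  finally have main: "(\<Sum>y\<in>V - W. f (dg W y) - f (dg (W - R) y)) \<ge>
     \<delta> * (\<Sum>r\<in>R. int \<Delta> - int (dg W r)) + (\<Sum>y\<in>Y. f (dg W y) - \<delta> * int (dg W y))" .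
  have "(\<Sum>y\<in>V - (W - R). f (dg (W - R) y)) =
      (\<Sum>y\<in>V - W. f (dg (W - R) y)) + (\<Sum>r\<in>R. f (dg (W - R) r))"
    unfolding split using fin R by (intro sum.union_disjoint) auto
  moreover have "a * int (card (W - R)) = a * int (card W) - a * int (card R)"
    using fin R card_mono[of W R] by (simp add: card_Diff_subset of_nat_diff right_diff_distrib)
  ultimately have "pot a f W - pot a f (W - R) = a * int (card R)
      + (\<Sum>y\<in>V - W. f (dg W y) - f (dg (W - R) y)) - (\<Sum>r\<in>R. f (dg (W - R) r))"
    by (simp add: pot_def sum_subtractf algebra_simps)
  moreover have "(\<Sum>r\<in>R. a + \<delta> * (int \<Delta> - int (dg W r)) - f (dg (W - R) r)) =
      a * int (card R) + \<delta> * (\<Sum>r\<in>R. int \<Delta> - int (dg W r)) - (\<Sum>r\<in>R. f (dg (W - R) r))"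
    by (simp add: sum.distrib sum_subtractf sum_distrib_left right_diff_distrib)
  ultimately show ?thesis using main by linarith
qed

text \<open>A chosen vertex keeps no undominated neighbour. Any other newly dominated vertex has a
  chosen neighbour, which is dominated too, so fewer than \<Delta> undominated neighbours
  remain.\<close>

lemma state_step:
  assumes "state W"
  shows "state (W - reach S)"
  unfolding state_def
proof (intro conjI ballI)
  show "W - reach S \<subseteq> full" using assms by (auto simp: state_def)
  fix y assume y: "y \<in> V - (W - reach S)"
  show "dg (W - reach S) y < \<Delta>"
  proof (cases "y \<in> W")
    case False
    then have "dg W y < \<Delta>" using assms y by (auto simp: state_def)
    then show ?thesis using dg_mono[of "W - reach S" W y] by auto
  next
    case True
    then consider "y \<in> S" | s where "s \<in> S" "y \<in> N s" using y by (auto simp: reach_def)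
    then show ?thesis
    proof cases
      case 1
      then have "dg (W - reach S) y = 0" by (intro dg_eq_0) (auto simp: reach_def)
      then show ?thesis using \<Delta>_pos by simp
    next
      case 2
      \<comment> \<open>\<open>dg UNIV y\<close> is the degree of \<open>y\<close> in the whole
        graph.\<close>
      then have "dg (W - reach S) y < dg UNIV y"
        by (intro dg_less[of s]) (auto simp: reach_def N_commute)
      then show ?thesis using dg_le[of UNIV y] by simp
    qed
  qed
qed

lemma state_full: "state full"
  unfolding state_def
proof (intro conjI ballI)
  fix y assume "y \<in> V - full"
  then have "card (N y) < \<Delta>" using card_N_le[of y] by (auto simp: full_def)
  moreover have "dg full y \<le> card (N y)" unfolding dg_def by (rule card_mono) auto
  ultimately show "dg full y < \<Delta>" by simp
qed simp

text \<open>Induction on \<open>card W\<close>: every step shrinks \<open>W\<close> and lowers the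
  potential by at least \<open>T\<close> per chosen vertex, and the drops telescope. At the empty
  set the potential is 0 because \<open>f 0 = 0\<close>.\<close>

lemma domination_by_potential:
  assumes step: "\<And>W. state W \<Longrightarrow> W \<noteq> {} \<Longrightarrow>
      \<exists>S\<subseteq>V. W \<inter> reach S \<noteq> {} \<and> T * int (card S) \<le> pot a f W - pot a f (W - reach S)"
    and "f 0 = 0" "T \<ge> 0" "state W"
  shows "\<exists>D\<subseteq>V. W \<subseteq> reach D \<and> T * int (card D) \<le> pot a f W"
  using \<open>state W\<close>
proof (induction "card W" arbitrary: W rule: less_induct)
  case less
  show ?case
  proof (cases "W = {}")
    case True
    then show ?thesis using \<open>f 0 = 0\<close> by (intro exI[of _ "{}"]) (simp add: pot_def dg_def)
  next
    case False
    then obtain S where S: "S \<subseteq> V" "W \<inter> reach S \<noteq> {}"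
      "T * int (card S) \<le> pot a f W - pot a f (W - reach S)"
      using step[OF less.prems False] by blast
    have "card (W - reach S) < card W"
      using S(2) state_finite[OF less.prems] by (intro psubset_card_mono) auto
    from less.hyps[OF this state_step[OF less.prems]]
    obtain D where D: "D \<subseteq> V" "W - reach S \<subseteq> reach D"
      "T * int (card D) \<le> pot a f (W - reach S)" by blast
    have "card (S \<union> D) \<le> card S + card D" by (rule card_Un_le)
    then have "T * int (card (S \<union> D)) \<le> T * int (card S) + T * int (card D)"
      using \<open>T \<ge> 0\<close> by (simp flip: distrib_left of_nat_add add: mult_left_mono)
    then show ?thesis using S D by (intro exI[of _ "S \<union> D"]) (auto simp: reach_def)
  qed
qed

text \<open>Initially no vertex weighs more than \<open>a\<close>, so
  \<open>domination_by_potential\<close> with positive \<open>T\<close> yields \<open>card D\<close>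
  at most \<open>a / T\<close> times \<open>card V\<close>.\<close>

lemma pot_full_le:
  assumes f: "\<And>j. j < \<Delta> \<Longrightarrow> f j \<le> a"
  shows "pot a f full \<le> a * int (card V)"
proof -
  have "(\<Sum>y\<in>V - full. f (dg full y)) \<le> (\<Sum>y\<in>V - full. a)"
    using state_full by (intro sum_mono f) (auto simp: state_def)
  moreover have "int (card (V - full)) = int (card V) - int (card full)"
    using full_subset finite_V card_mono[of V full]
    by (simp add: card_Diff_subset of_nat_diff finite_subset)
  ultimately show ?thesis by (simp add: pot_def algebra_simps)
qed

section \<open>Potential drop from choosing a single vertex\<close>

lemma reach_singleton: "reach {v} = insert v (N v)"
  by (auto simp: reach_def)

text \<open>The chosen \<open>v\<close> keeps no undominated neighbour, so its new weight is
  \<open>f 0 = 0\<close>. Each of its neighbours in \<open>W\<close> loses at least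
  \<open>v\<close>, which is why \<open>j\<close> is strictly below \<open>dg W u\<close>.\<close>

lemma pick_inside:
  assumes W: "state W" and v: "v \<in> W"
    and slope: "\<And>i j. i \<le> j \<Longrightarrow> j \<le> M \<Longrightarrow> f i + \<delta> * (int j - int i) \<le> f j"
    and M: "\<And>y. y \<in> V - W \<Longrightarrow> dg W y \<le> M"
    and f0: "f 0 = 0"
    and c: "\<And>u j. u \<in> N v \<inter> W \<Longrightarrow> j < dg W u \<Longrightarrow> c \<le> a + \<delta> * (int \<Delta> - int (dg W u)) - f j"
  shows "a + \<delta> * (int \<Delta> - int (dg W v)) + c * int (dg W v)
    \<le> pot a f W - pot a f (W - reach {v})"
proof -
  let ?R = "insert v (N v \<inter> W)"
  let ?g = "\<lambda>r. a + \<delta> * (int \<Delta> - int (dg W r)) - f (dg (W - ?R) r)"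
  have R: "W - reach {v} = W - ?R" by (auto simp: reach_singleton)
  have "(\<Sum>r\<in>N v \<inter> W. c) \<le> (\<Sum>r\<in>N v \<inter> W. ?g r)"
  proof (intro sum_mono c)
    fix r assume "r \<in> N v \<inter> W"
    then show "dg (W - ?R) r < dg W r"
      using v by (intro dg_less[of v]) (auto simp: N_commute)
  qed
  moreover have "dg (W - ?R) v = 0" by (intro dg_eq_0) auto
  moreover have "pot a f W - pot a f (W - ?R) \<ge> (\<Sum>r\<in>?R. ?g r)"
    using pot_drop[OF W _ slope M f0, of ?R "{}" a] v by auto
  ultimately show ?thesis
    unfolding R using N_irrefl[of v] f0 by (simp add: dg_def mult.commute)
qed

text \<open>The vertex \<open>y\<close> loses all its undominated neighbours and serves as the set
  \<open>Y\<close> of \<open>pot_drop\<close>. As \<open>y\<close> is not in \<open>W\<close>, its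
  neighbours may keep all their undominated neighbours, so only \<open>j \<le> dg W u\<close> is
  available.\<close>

lemma pick_outside:
  assumes W: "state W" and y: "y \<in> V - W"
    and slope: "\<And>i j. i \<le> j \<Longrightarrow> j \<le> M \<Longrightarrow> f i + \<delta> * (int j - int i) \<le> f j"
    and M: "\<And>y. y \<in> V - W \<Longrightarrow> dg W y \<le> M"
    and f0: "f 0 = 0"
    and c: "\<And>u j. u \<in> N y \<inter> W \<Longrightarrow> j \<le> dg W u \<Longrightarrow> c \<le> a + \<delta> * (int \<Delta> - int (dg W u)) - f j"
  shows "c * int (dg W y) + f (dg W y) - \<delta> * int (dg W y)
    \<le> pot a f W - pot a f (W - reach {y})"
proof -
  let ?R = "N y \<inter> W"
  let ?g = "\<lambda>r. a + \<delta> * (int \<Delta> - int (dg W r)) - f (dg (W - ?R) r)"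
  have R: "W - reach {y} = W - ?R" using y by (auto simp: reach_singleton)
  have "(\<Sum>r\<in>?R. c) \<le> (\<Sum>r\<in>?R. ?g r)"
    by (intro sum_mono c dg_mono) auto
  moreover have "pot a f W - pot a f (W - ?R) \<ge> (\<Sum>r\<in>?R. ?g r)
      + (\<Sum>y\<in>{y}. f (dg W y) - \<delta> * int (dg W y))"
    using y by (intro pot_drop[OF W _ slope M f0]) auto
  ultimately show ?thesis
    unfolding R by (simp add: dg_def mult.commute)
qed

lemma max_dg:
  assumes "state W" "W \<noteq> {}"
  obtains v where "v \<in> W" "\<And>u. u \<in> W \<Longrightarrow> dg W u \<le> dg W v"
proof -
  have "finite (dg W ` W)" "dg W ` W \<noteq> {}" using assms state_finite by auto
  then have "Max (dg W ` W) \<in> dg W ` W" "\<forall>u\<in>W. dg W u \<le> Max (dg W ` W)"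
    by (auto intro: Max_in)
  then show ?thesis using that by (metis imageE)
qed

section \<open>Maximum degree five\<close>

text \<open>
  In units of \<open>1/140\<close> of a chosen vertex. The weights are a feasible solution, found by linear programming, of the
  inequalities required in \<open>domination5_step\<close>; the undominated weight \<open>50\<close> makes the initial potential at most
  \<open>50n = 140 * (5n/14)\<close>.
\<close>
definition weight5 :: "nat \<Rightarrow> int" where
  "weight5 j = (if j = 0 then 0 else if j = 1 then 18 else if j = 2 then 23
    else if j = 3 then 28 else 30)"

lemma weight5_simps [simp]:
  "weight5 0 = 0" "weight5 (Suc 0) = 18" "weight5 2 = 23" "weight5 3 = 28" "weight5 4 = 30"
  by (simp_all add: weight5_def)

lemma weight5_mono: "i \<le> j \<Longrightarrow> weight5 i \<le> weight5 j"
  by (auto simp: weight5_def)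

text \<open>The increments of \<open>weight5\<close> are 18, 5, 5, 2, so a cap of 4, 3 or 1 on the
  undominated neighbours of outside vertices permits slope 2, 5 or 18. Let \<open>v\<close> have
  maximal degree in \<open>W\<close>. Choose \<open>v\<close> if that degree is at least 3;
  otherwise an outside vertex with 4 undominated neighbours; otherwise \<open>v\<close> if it is not
  isolated in \<open>W\<close>; otherwise an outside vertex with 2 or 3 undominated neighbours;
  otherwise \<open>v\<close>.\<close>

lemma domination5_step:
  assumes \<Delta>: "\<Delta> = 5" and W: "state W" "W \<noteq> {}"
  shows "\<exists>v\<in>V. W \<inter> reach {v} \<noteq> {} \<and> 140 \<le> pot 50 weight5 W - pot 50 weight5 (W - reach {v})"
proof -
  have f0: "weight5 0 = 0" by (simp add: weight5_def)
  have M4: "dg W y \<le> 4" if "y \<in> V - W" for y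
    using state_dg_less[OF W(1) that] unfolding \<Delta> by simp
  have slope4: "weight5 i + 2 * (int j - int i) \<le> weight5 j" if "i \<le> j" "j \<le> 4" for i j
  proof -
    have "i = 0 \<or> i = 1 \<or> i = 2 \<or> i = 3 \<or> i = 4" "j = 0 \<or> j = 1 \<or> j = 2 \<or> j = 3 \<or> j = 4" using that by linarith+
    then show ?thesis using that by (elim disjE) (simp_all add: weight5_def)
  qed
  have slope3: "weight5 i + 5 * (int j - int i) \<le> weight5 j" if "i \<le> j" "j \<le> 3" for i j
  proof -
    have "i = 0 \<or> i = 1 \<or> i = 2 \<or> i = 3" "j = 0 \<or> j = 1 \<or> j = 2 \<or> j = 3" using that by linarith+
    then show ?thesis using that by (elim disjE) (simp_all add: weight5_def)
  qed
  have slope1: "weight5 i + 18 * (int j - int i) \<le> weight5 j" if "i \<le> j" "j \<le> 1" for i j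
  proof -
    have "i = 0 \<or> i = 1" "j = 0 \<or> j = 1" using that by linarith+
    then show ?thesis using that by (elim disjE) (simp_all add: weight5_def)
  qed
  have WV: "W \<subseteq> V" using W(1) by (rule state_subset)
  obtain v where v: "v \<in> W" and v_max: "\<And>u. u \<in> W \<Longrightarrow> dg W u \<le> dg W v"
    using max_dg[OF W] by metis
  have v_drop: ?thesis if "140 \<le> pot 50 weight5 W - pot 50 weight5 (W - reach {v})"
    using that v WV by (intro bexI[of _ v]) (auto simp: reach_singleton)
  have y_drop: ?thesis if "140 \<le> pot 50 weight5 W - pot 50 weight5 (W - reach {y})"
    "y \<in> V" "dg W y \<noteq> 0" for y
    using that by (intro bexI[of _ y]) (auto simp: reach_singleton dg_eq_0_iff)
  have v5: "dg W v \<le> 5" using dg_le[of W v] \<Delta> by simp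
  \<comment> \<open>Maximality of \<open>dg W v\<close> makes the bounds for neighbours depend on
    \<open>dg W v\<close> alone. The truncated \<open>dg W v - 1\<close> is harmless, since
    \<open>j < dg W u\<close> forces \<open>dg W v\<close> to be positive.\<close>
  have white: "50 + \<delta> * (5 - int (dg W v)) - weight5 (dg W v - 1)
        \<le> 50 + \<delta> * (int \<Delta> - int (dg W u)) - weight5 j"
    if "u \<in> N v \<inter> W" "j < dg W u" "\<delta> \<ge> 0" for u j \<delta>
  proof -
    have "dg W u \<le> dg W v" using v_max that by auto
    then have "weight5 j \<le> weight5 (dg W v - 1)" "\<delta> * int (dg W u) \<le> \<delta> * int (dg W v)"
      using that by (auto intro: weight5_mono mult_left_mono)
    then show ?thesis by (simp add: \<Delta> algebra_simps)
  qed
  have black: "50 + \<delta> * (5 - int (dg W v)) - weight5 (dg W v)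
        \<le> 50 + \<delta> * (int \<Delta> - int (dg W u)) - weight5 j"
    if "u \<in> N y \<inter> W" "j \<le> dg W u" "\<delta> \<ge> 0" for u j \<delta> y
  proof -
    have "dg W u \<le> dg W v" using v_max that by auto
    then have "weight5 j \<le> weight5 (dg W v)" "\<delta> * int (dg W u) \<le> \<delta> * int (dg W v)"
      using that by (auto intro: weight5_mono mult_left_mono)
    then show ?thesis by (simp add: \<Delta> algebra_simps)
  qed
  show ?thesis
  proof (cases "dg W v \<ge> 3")
    case True
    then have "dg W v \<in> {3, 4, 5}" using v5 by auto
    then show ?thesis
      using pick_inside[OF W(1) v slope4 M4 f0 white] \<Delta>
      by (intro v_drop) auto
  next
    case small: False
    show ?thesis
    proof (cases "\<exists>y\<in>V - W. dg W y = 4")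
      case True
      then obtain y where y: "y \<in> V - W" "dg W y = 4" by blast
      have "dg W v \<in> {0, 1, 2}" using small by auto
      then show ?thesis
        using pick_outside[OF W(1) y(1) slope4 M4 f0 black[where y = y]] y
        by (intro y_drop[of y]) auto
    next
      case False
      have M3: "dg W y \<le> 3" if "y \<in> V - W" for y
      proof -
        have "dg W y \<noteq> 4" using False that by blast
        then show ?thesis using M4[OF that] by simp
      qed
      show ?thesis
      proof (cases "dg W v = 0")
        case False
        then have "dg W v \<in> {1, 2}" using small by auto
        \<comment> \<open>For \<open>dg W v = 1\<close> the bound is exactly 70 + 70 = 140.\<close>
        then show ?thesis
          using pick_inside[OF W(1) v slope3 M3 f0 white] \<Delta>
          by (intro v_drop) auto
      next
        case single: True
        show ?thesis
        proof (cases "\<exists>y\<in>V - W. dg W y \<ge> 2")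
          case True
          then obtain y where y: "y \<in> V - W" "dg W y \<ge> 2" by blast
          then have "dg W y \<in> {2, 3}" using M3[of y] by auto
          then show ?thesis
            using pick_outside[OF W(1) y(1) slope3 M3 f0 black[where y = y]] y single
            by (intro y_drop[of y]) auto
        next
          case False
          then have M1: "dg W y \<le> 1" if "y \<in> V - W" for y using that by force
          \<comment> \<open>Here the bound is again exact: 50 + 18 * 5 = 140.\<close>
          show ?thesis
            using pick_inside[OF W(1) v slope1 M1 f0 white] single \<Delta>
            by (intro v_drop) auto
        qed
      qed
    qed
  qed
qed

lemma domination5:
  assumes "\<Delta> = 5"
  shows "\<exists>D\<subseteq>V. full \<subseteq> reach D \<and> 14 * card D \<le> 5 * card V"
proof -
  have "\<exists>D\<subseteq>V. full \<subseteq> reach D \<and> 140 * int (card D) \<le> pot 50 weight5 full"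
  proof (rule domination_by_potential[OF _ _ _ state_full])
    fix W assume "state W" "W \<noteq> {}"
    from domination5_step[OF assms this]
    obtain v where "v \<in> V" "W \<inter> reach {v} \<noteq> {}"
      "140 \<le> pot 50 weight5 W - pot 50 weight5 (W - reach {v})" by blast
    then show "\<exists>S\<subseteq>V. W \<inter> reach S \<noteq> {} \<and>
        140 * int (card S) \<le> pot 50 weight5 W - pot 50 weight5 (W - reach S)"
      by (intro exI[of _ "{v}"]) auto
  qed (auto simp: weight5_def)
  then obtain D where "D \<subseteq> V" "full \<subseteq> reach D" "140 * int (card D) \<le> pot 50 weight5 full"
    by blast
  moreover have "pot 50 weight5 full \<le> 50 * int (card V)"
    by (intro pot_full_le) (auto simp: weight5_def)
  ultimately show ?thesis by (intro exI[of _ D]) simp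
qed

section \<open>Maximum degree four\<close>

text \<open>
  In units of \<open>1/44\<close> of a chosen vertex, undominated vertices having weight \<open>16 = 44 * 4/11\<close>.
\<close>
definition weight4 :: "nat \<Rightarrow> int" where
  "weight4 j = (if j = 0 then 0 else 6 + int j)"

text \<open>The contribution of \<open>r \<in> R\<close> in \<open>pot_drop\<close> for \<open>a = 16\<close> and \<open>\<delta> = 1\<close>.\<close>
definition gain4 :: "'a set \<Rightarrow> 'a set \<Rightarrow> 'a \<Rightarrow> int" where
  "gain4 W R r = 20 - int (dg W r) - weight4 (dg (W - R) r)"

definition good4 :: "'a set \<Rightarrow> bool" where
  "good4 W \<longleftrightarrow> (\<exists>S\<subseteq>V. W \<inter> reach S \<noteq> {} \<and>
    44 * int (card S) \<le> pot 16 weight4 W - pot 16 weight4 (W - reach S))"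

text \<open>This is \<open>pot_drop\<close> with slope 1. Since positive weights are 6 +
  \<open>j\<close>, every outside vertex that loses all its undominated neighbours, having had at
  least one, releases a bonus of 6.\<close>

lemma good4I:
  assumes \<Delta>: "\<Delta> = 4" and W: "state W" and R: "W \<inter> reach S = R" "R \<noteq> {}" and "S \<subseteq> V"
    and Y: "Y \<subseteq> V - W" "\<And>y. y \<in> Y \<Longrightarrow> N y \<inter> W \<noteq> {} \<and> N y \<inter> W \<subseteq> R"
    and le: "44 * int (card S) \<le> (\<Sum>r\<in>R. gain4 W R r) + 6 * int (card Y)"
  shows "good4 W"
proof -
  have RW: "R \<subseteq> W" "W - reach S = W - R" using R(1) by auto
  have "pot 16 weight4 W - pot 16 weight4 (W - R) \<ge>
    (\<Sum>r\<in>R. 16 + 1 * (int \<Delta> - int (dg W r)) - weight4 (dg (W - R) r))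
    + (\<Sum>y\<in>Y. weight4 (dg W y) - 1 * int (dg W y))"
    using Y by (intro pot_drop[OF W RW(1), of \<Delta>]) (auto simp: weight4_def dg_le)
  also have "(\<Sum>y\<in>Y. weight4 (dg W y) - 1 * int (dg W y)) = (\<Sum>y\<in>Y. 6)"
    using Y(2) by (intro sum.cong) (auto simp: weight4_def dg_eq_0_iff)
  finally show ?thesis
    unfolding good4_def using assms RW
    by (intro exI[of _ S]) (simp add: gain4_def)
qed

lemma gain4_inner: "N r \<inter> W \<subseteq> R \<Longrightarrow> gain4 W R r = 20 - int (dg W r)"
  using dg_eq_0[of r "W - R"] by (auto simp: gain4_def weight4_def)

text \<open>The extreme case is 20 - 2 - \<open>weight4 2\<close> = 10.\<close>

lemma gain4_ge:
  assumes "dg W r \<le> 2"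
  shows "10 \<le> gain4 W R r"
  using dg_mono[of "W - R" W r] assms by (auto simp: gain4_def weight4_def)

text \<open>Losing \<open>u\<close> leaves at most one undominated neighbour; the extreme case is 20
  - 2 - \<open>weight4 1\<close> = 11.\<close>

lemma gain4_border:
  assumes "u \<in> N r" "u \<in> W" "u \<in> R" "dg W r \<le> 2"
  shows "11 \<le> gain4 W R r"
  using dg_less[of u r W "W - R"] assms by (auto simp: gain4_def weight4_def)

lemma dg_1E:
  assumes "dg W v = 1" "u \<in> N v" "u \<in> W"
  shows "N v \<inter> W = {u}"
proof -
  obtain x where "N v \<inter> W = {x}" using assms(1) card_1_singletonE unfolding dg_def by metis
  then show ?thesis using assms by auto
qed

lemma dg_2E:
  assumes "dg W v = 2" "u \<in> N v" "u \<in> W"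
  obtains x where "N v \<inter> W = {u, x}" "x \<noteq> u" "x \<in> W" "x \<in> N v"
proof -
  obtain a b where ab: "N v \<inter> W = {a, b}" "a \<noteq> b"
    using assms(1) unfolding dg_def card_2_iff by blast
  then have "a \<in> N v \<inter> W" "b \<in> N v \<inter> W" "u = a \<or> u = b" using assms(2,3) by blast+
  then show ?thesis using ab that[of a] that[of b] by (auto simp: insert_commute)
qed

section \<open>Steps that exclude all components of \<open>W\<close> but isolated vertices, edges
  and 4-cycles\<close>

text \<open>Choosing a vertex of maximal degree \<open>t\<close> in \<open>W\<close> lowers the
  potential by at least 20 - \<open>t\<close> + \<open>t\<close> * (15 - 2 * \<open>t\<close>),
  which is exactly 44 both for \<open>t\<close> = 3 and for \<open>t\<close> = 4.\<close>

lemma good4_large_degree: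
  assumes \<Delta>: "\<Delta> = 4" and W: "state W" "v \<in> W" "dg W v \<ge> 3"
  shows "good4 W"
proof -
  obtain v where v: "v \<in> W" and v_max: "\<And>u. u \<in> W \<Longrightarrow> dg W u \<le> dg W v"
    using max_dg[OF W(1)] W(2) by blast
  have le: "dg W v \<le> 4" using dg_le[of W v] \<Delta> by simp
  have ge: "dg W v \<ge> 3" using v_max[OF W(2)] W(3) by simp
  \<comment> \<open>The neighbour \<open>u\<close> has degree at most \<open>dg W v\<close> and
    loses \<open>v\<close>, so its new weight is at most 5 + \<open>dg W v\<close>.\<close>
  have *: "15 - 2 * int (dg W v) \<le> 16 + 1 * (int \<Delta> - int (dg W u)) - weight4 j"
    if "u \<in> N v \<inter> W" "j < dg W u" for u j
    using v_max[of u] that \<Delta> by (auto simp: weight4_def)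
  have "16 + 1 * (int \<Delta> - int (dg W v)) + (15 - 2 * int (dg W v)) * int (dg W v)
      \<le> pot 16 weight4 W - pot 16 weight4 (W - reach {v})"
    using * by (intro pick_inside[OF W(1) v, of \<Delta>]) (auto simp: weight4_def dg_le)
  moreover have "dg W v = 3 \<or> dg W v = 4" using le ge by linarith
  ultimately have "44 \<le> pot 16 weight4 W - pot 16 weight4 (W - reach {v})"
    by (elim disjE) (simp_all add: \<Delta>)
  then show ?thesis unfolding good4_def using v state_subset[OF W(1)]
    by (intro exI[of _ "{v}"]) (auto simp: reach_singleton)
qed

text \<open>Choosing \<open>v\<close> gains 18 from \<open>v\<close>, 19 from \<open>u\<close> and
  at least 11 from the other neighbour, in total at least 48.\<close>

lemma good4_path_end:
  assumes \<Delta>: "\<Delta> = 4" and W: "state W" "v \<in> W" "dg W v = 2" "u \<in> N v" "u \<in> W" "dg W u = 1"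
    and le2: "\<And>w. w \<in> W \<Longrightarrow> dg W w \<le> 2"
  shows "good4 W"
proof -
  obtain x where x: "N v \<inter> W = {u, x}" "x \<noteq> u" "x \<in> W" "x \<in> N v"
    using dg_2E[OF W(3,4,5)] .
  let ?R = "{v, u, x}"
  have "v \<noteq> u" "v \<noteq> x" using W(4) x N_irrefl by auto
  have "N u \<inter> W = {v}" using dg_1E[OF W(6)] W N_sym by blast
  then have "gain4 W ?R u = 19" "gain4 W ?R v = 18" using x(1) W by (subst gain4_inner; auto)+
  moreover have "11 \<le> gain4 W ?R x" using W x le2 N_sym by (intro gain4_border[of v]) auto
  ultimately have "44 \<le> (\<Sum>r\<in>?R. gain4 W ?R r)"
    using \<open>v \<noteq> u\<close> \<open>v \<noteq> x\<close> x(2) by simp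
  then show ?thesis
    using W x state_subset[OF W(1)]
    by (intro good4I[OF \<Delta> W(1), of "{v}" ?R "{}"]) (auto simp: reach_singleton)
qed

text \<open>The triangle is a whole component of \<open>W\<close>, so choosing \<open>v\<close>
  gains at least 3 * 18 = 54.\<close>

lemma good4_triangle:
  assumes \<Delta>: "\<Delta> = 4" and W: "state W" "v \<in> W" "N v \<inter> W = {u, x}" "u \<noteq> x" "u \<in> N x"
    and le2: "\<And>w. w \<in> W \<Longrightarrow> dg W w \<le> 2"
  shows "good4 W"
proof -
  let ?R = "{v, u, x}"
  have ux: "u \<in> W" "x \<in> W" "u \<in> N v" "x \<in> N v" "x \<in> N u" "v \<in> N u" "v \<in> N x"
    using W N_sym by blast+
  have ne: "v \<noteq> u" "v \<noteq> x" using ux N_irrefl by auto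
  have full2: "A = N w \<inter> W" if "A \<subseteq> N w \<inter> W" "card A = 2" "w \<in> W" for A w
    using that le2[OF that(3)] by (intro card_seteq) (auto simp: dg_def)
  have "{v, x} = N u \<inter> W" "{v, u} = N x \<inter> W"
    using ux ne W by (intro full2; auto)+
  then have "gain4 W ?R r \<ge> 18" if "r \<in> ?R" for r
    using that le2[of r] ux W(2,3) by (subst gain4_inner) auto
  then have "(\<Sum>r\<in>?R. 18) \<le> (\<Sum>r\<in>?R. gain4 W ?R r)" by (intro sum_mono)
  then have "44 \<le> (\<Sum>r\<in>?R. gain4 W ?R r)" using ne W(4) by simp
  then show ?thesis
    using W ux state_subset[OF W(1)]
    by (intro good4I[OF \<Delta> W(1), of "{v}" ?R "{}"]) (auto simp: reach_singleton)
qed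

text \<open>Along the path \<open>u'\<close>, \<open>u\<close>, \<open>v\<close>, \<open>x\<close>,
  \<open>x'\<close>, \<open>q\<close> the choice of \<open>u\<close> and \<open>x'\<close> dominates
  everything. The four inner vertices gain 18 each and the ends 11 each, in total 94; if
  \<open>q = u'\<close>, the path closes to a 5-cycle and gains 5 * 18 = 90.\<close>

lemma good4_long_cycle:
  assumes \<Delta>: "\<Delta> = 4" and W: "state W" "v \<in> W" "N v \<inter> W = {u, x}" "u \<noteq> x"
    and u: "N u \<inter> W = {v, u'}" "u' \<noteq> v" "u' \<noteq> x"
    and x: "N x \<inter> W = {v, x'}" "x' \<noteq> v" "x' \<noteq> u"
    and x': "N x' \<inter> W = {x, q}" "q \<noteq> x"
    and ne: "u' \<noteq> x'"
    and le2: "\<And>w. w \<in> W \<Longrightarrow> dg W w \<le> 2"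
  shows "good4 W"
proof -
  have in_W: "u \<in> W" "x \<in> W" "u' \<in> W" "x' \<in> W" "q \<in> W" using W u x x' by auto
  have adj: "v \<in> N u" "v \<in> N x" "u \<in> N v" "x \<in> N v" "u' \<in> N u" "u \<in> N u'" "x' \<in> N x"
    "x \<in> N x'" "q \<in> N x'" "x' \<in> N q"
    using W(3) u(1) x(1) x'(1) N_sym by blast+
  have irr: "v \<noteq> u" "v \<noteq> x" "u \<noteq> u'" "x \<noteq> x'" "q \<noteq> x'" using adj N_irrefl by auto
  have q: "q \<noteq> u" "q \<noteq> v"
  proof -
    show "q \<noteq> u"
    proof
      assume "q = u"
      then have "x' \<in> N u \<inter> W" using adj(10) in_W by auto
      then show False using u(1) x(2) ne by auto
    qed
    show "q \<noteq> v"
    proof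
      assume "q = v"
      then have "x' \<in> N v \<inter> W" using adj(10) in_W by auto
      then show False using W(3) x(3) irr by auto
    qed
  qed
  let ?R = "{u', u, v, x, x', q}"
  have g: "18 \<le> gain4 W ?R r" if "r \<in> {u, v, x, x'}" for r
  proof -
    have "r \<in> W" "N r \<inter> W \<subseteq> ?R" using that W(2,3) in_W u(1) x(1) x'(1) by auto
    then show ?thesis using le2[of r] by (subst gain4_inner) auto
  qed
  have g': "11 \<le> gain4 W ?R u'" using adj in_W le2 by (intro gain4_border[of u]) auto
  have g'': "11 \<le> gain4 W ?R q" using adj in_W le2 by (intro gain4_border[of x']) auto
  have "88 \<le> (\<Sum>r\<in>?R. gain4 W ?R r)"
  proof (cases "q = u'")
    case True
    have "u \<in> N u' \<inter> W" "x' \<in> N u' \<inter> W" using adj in_W True by auto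
    moreover have "card {u, x'} = 2" using x(3) by auto
    ultimately have "{u, x'} = N u' \<inter> W"
      using le2[of u'] in_W by (intro card_seteq) (auto simp: dg_def)
    then have "18 \<le> gain4 W ?R u'" using le2[of u'] in_W by (subst gain4_inner) auto
    then show ?thesis
      using True g[of u] g[of v] g[of x] g[of x'] irr W(4) u x ne by (simp add: insert_commute)
  next
    case False
    then show ?thesis
      using g[of u] g[of v] g[of x] g[of x'] g' g'' irr q W(4) u x x' ne by simp
  qed
  moreover have "card {u, x'} = 2" using x(3) by auto
  ultimately show ?thesis
    using W(2,3) in_W u(1) x(1) x'(1) state_subset[OF W(1)]
    by (intro good4I[OF \<Delta> W(1), of "{u, x'}" ?R "{}"]) (auto simp: reach_def)
qed

text \<open>
  Once all degrees in \<open>W\<close> are at most two and no step is possible, the components of \<open>W\<close> are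
  isolated vertices, edges and 4-cycles.
\<close>
lemma good4_or_square:
  assumes \<Delta>: "\<Delta> = 4" and W: "state W" and le2: "\<And>w. w \<in> W \<Longrightarrow> dg W w \<le> 2"
    and ng: "\<not> good4 W" and v: "v \<in> W" "dg W v = 2"
  obtains u x z where "N v \<inter> W = {u, x}" "N u \<inter> W = {v, z}" "N x \<inter> W = {v, z}"
    "N z \<inter> W = {u, x}" "u \<noteq> x" "v \<noteq> z"
proof -
  have deg: "dg W b = 2" if "a \<in> W" "dg W a = 2" "b \<in> N a" "b \<in> W" for a b
  proof -
    have "dg W b \<noteq> 1" using good4_path_end[OF \<Delta> W that(1,2,3,4) _ le2] ng by blast
    moreover have "dg W b \<noteq> 0" using that N_sym by (auto simp: dg_eq_0_iff)
    ultimately show ?thesis using le2[OF that(4)] by linarith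
  qed
  obtain u x where ux: "N v \<inter> W = {u, x}" "u \<noteq> x"
    using v(2) unfolding dg_def card_2_iff by blast
  then have in_W: "u \<in> W" "x \<in> W" and adj: "u \<in> N v" "x \<in> N v" "v \<in> N u" "v \<in> N x"
    using N_sym by blast+
  have "u \<notin> N x" using good4_triangle[OF \<Delta> W v(1) ux _ le2] ng by blast
  then have "x \<notin> N u" using N_sym by blast
  have d: "dg W u = 2" "dg W x = 2" using deg[OF v] in_W adj by auto
  obtain u' where u': "N u \<inter> W = {v, u'}" "u' \<noteq> v" "u' \<in> W" "u' \<in> N u"
    using dg_2E[OF d(1) adj(3) v(1)] .
  obtain x' where x': "N x \<inter> W = {v, x'}" "x' \<noteq> v" "x' \<in> W" "x' \<in> N x"
    using dg_2E[OF d(2) adj(4) v(1)] .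
  have d': "dg W x' = 2" using deg[OF in_W(2) d(2) x'(4,3)] .
  obtain q where q: "N x' \<inter> W = {x, q}" "q \<noteq> x"
    using dg_2E[OF d' N_sym[OF x'(4)] in_W(2)] .
  \<comment> \<open>Otherwise \<open>good4_long_cycle\<close> applies, triangles being excluded
    already; so \<open>v\<close> lies on a 4-cycle.\<close>
  have "u' = x'"
    using good4_long_cycle[OF \<Delta> W v(1) ux u'(1,2) _ x'(1,2) _ q _ le2] ng
      \<open>u \<notin> N x\<close> \<open>x \<notin> N u\<close> u' x' by blast
  then have "u \<in> N x' \<inter> W" using u' N_sym in_W by auto
  then have "N x' \<inter> W = {u, x}" using q ux by auto
  then show ?thesis using that[of u x x'] ux u' x' \<open>u' = x'\<close> by auto
qed

section \<open>Outside vertices adjacent to isolated vertices of \<open>W\<close>\<close>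

definition isolated :: "'a set \<Rightarrow> 'a set" where
  "isolated W = {w \<in> W. dg W w = 0}"

definition shared :: "'a set \<Rightarrow> 'a \<Rightarrow> bool" where
  "shared W y \<longleftrightarrow> N y \<inter> isolated W \<noteq> {}"

lemma isolated_N: "s \<in> isolated W \<Longrightarrow> N s \<inter> W = {}"
  by (simp add: isolated_def dg_eq_0_iff)

lemma isolated_subset: "isolated W \<subseteq> W"
  by (auto simp: isolated_def)

lemma gain4_isolated: "s \<in> isolated W \<Longrightarrow> gain4 W R s = 20"
  using gain4_inner[of s W R] by (simp add: isolated_def dg_eq_0_iff)

text \<open>Choosing \<open>y\<close> gains 20 from \<open>s\<close>, 6 from \<open>y\<close>
  itself, and 20 more, either from two vertices with at least 10 each or from a second isolated
  vertex.\<close>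

lemma good4_outside:
  assumes \<Delta>: "\<Delta> = 4" and W: "state W" and le2: "\<And>w. w \<in> W \<Longrightarrow> dg W w \<le> 2"
    and y: "y \<in> V - W" and s: "s \<in> N y \<inter> isolated W"
    and more: "3 \<le> card (N y \<inter> W) \<or> (\<exists>s'\<in>N y \<inter> isolated W. s' \<noteq> s)"
  shows "good4 W"
proof -
  let ?R = "N y \<inter> W" and ?g = "\<lambda>r. gain4 W (N y \<inter> W) r"
  have sR: "s \<in> ?R" using s isolated_subset by auto
  have g: "10 \<le> ?g r" if "r \<in> ?R" for r using le2[of r] that by (intro gain4_ge) auto
  have split: "(\<Sum>r\<in>?R. ?g r) = 20 + (\<Sum>r\<in>?R - {s}. ?g r)"
    using sR s by (subst sum.remove[of _ s]) (auto simp: gain4_isolated)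
  have "20 \<le> (\<Sum>r\<in>?R - {s}. ?g r)"
    using more
  proof
    assume "3 \<le> card ?R"
    then have "2 \<le> card (?R - {s})" using sR by (simp add: card_Diff_singleton)
    moreover have "(\<Sum>r\<in>?R - {s}. 10) \<le> (\<Sum>r\<in>?R - {s}. ?g r)"
      by (intro sum_mono g) auto
    ultimately show ?thesis by simp
  next
    assume "\<exists>s'\<in>N y \<inter> isolated W. s' \<noteq> s"
    then obtain s' where s': "s' \<in> N y \<inter> isolated W" "s' \<noteq> s" by blast
    have "0 \<le> (\<Sum>r\<in>?R - {s} - {s'}. ?g r)"
    proof (rule sum_nonneg)
      fix r assume "r \<in> ?R - {s} - {s'}"
      then show "0 \<le> ?g r" using g[of r] by simp
    qed
    then show ?thesis
      using s' isolated_subset by (subst sum.remove[of _ s']) (auto simp: gain4_isolated)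
  qed
  then show ?thesis
    using y sR split
    by (intro good4I[OF \<Delta> W, of "{y}" ?R "{y}"]) (auto simp: reach_singleton)
qed

text \<open>Choosing \<open>y\<close> and the corner \<open>z\<close> opposite to \<open>v\<close>
  dominates \<open>s\<close> and the whole 4-cycle, gaining at least 20 + 4 * 18 = 92 for two
  vertices.\<close>

lemma good4_square:
  assumes \<Delta>: "\<Delta> = 4" and W: "state W" and le2: "\<And>w. w \<in> W \<Longrightarrow> dg W w \<le> 2"
    and y: "y \<in> V - W" "N y \<inter> W = {s, v}" and s: "s \<in> isolated W"
    and v: "N v \<inter> W = {u, x}" "N u \<inter> W = {v, z}" "N x \<inter> W = {v, z}" "N z \<inter> W = {u, x}"
      "u \<noteq> x" "v \<noteq> z"
  shows "good4 W"
proof -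
  let ?R = "{s, v, u, x, z}"
  have in_W: "v \<in> W" "u \<in> W" "x \<in> W" "z \<in> W" using v by auto
  have adj: "u \<in> N v" "x \<in> N v" "u \<in> N z" "x \<in> N z" using v by blast+
  then have ne: "u \<noteq> v" "x \<noteq> v" "u \<noteq> z" "x \<noteq> z" using N_irrefl by auto
  have s_notin: "s \<notin> {v, u, x, z}" using isolated_N[OF s] v by auto
  have g: "18 \<le> gain4 W ?R r" if "r \<in> {v, u, x, z}" for r
    using that v in_W le2[of r] by (subst gain4_inner) auto
  have "88 \<le> (\<Sum>r\<in>?R. gain4 W ?R r)"
    using s_notin gain4_isolated[OF s] v(5,6) ne g[of v] g[of u] g[of x] g[of z] by simp
  moreover have "y \<noteq> z" using y in_W by auto
  ultimately show ?thesis
    using y(1) in_W state_subset[OF W] isolated_subset s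
    by (intro good4I[OF \<Delta> W, of "{y, z}" ?R "{}"])
      (auto simp: reach_def Int_Un_distrib2 Int_commute[of W] y(2) v(4))
qed

text \<open>Choosing \<open>y1\<close> and \<open>y2\<close> gains 20 from each isolated vertex, 19
  from each end of the edge and the two bonuses: 40 + 38 + 12 = 90.\<close>

lemma good4_pair:
  assumes \<Delta>: "\<Delta> = 4" and W: "state W" and u: "N u1 \<inter> W = {u2}" "N u2 \<inter> W = {u1}"
    and y: "y1 \<in> V - W" "N y1 \<inter> W = {s1, u1}" "y2 \<in> V - W" "N y2 \<inter> W = {s2, u2}"
    and s: "s1 \<in> isolated W" "s2 \<in> isolated W" "s1 \<noteq> s2"
  shows "good4 W"
proof -
  let ?R = "{s1, u1, s2, u2}"
  have "u2 \<in> N u1" using u by blast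
  then have "u1 \<noteq> u2" using N_irrefl by auto
  moreover have "s1 \<noteq> u1" "s1 \<noteq> u2" "s2 \<noteq> u1" "s2 \<noteq> u2"
    using isolated_N[OF s(1)] isolated_N[OF s(2)] u by auto
  moreover have "gain4 W ?R u1 = 19" "gain4 W ?R u2 = 19"
    using u by (subst gain4_inner; auto simp: dg_def)+
  ultimately have sum: "(\<Sum>r\<in>?R. gain4 W ?R r) = 78"
    using s by (simp add: gain4_isolated)
  have "y1 \<noteq> y2" using y s \<open>s1 \<noteq> u2\<close> by blast
  moreover have "W \<inter> reach {y1, y2} = ?R" using y by (auto simp: reach_def)
  ultimately show ?thesis
    using y sum by (intro good4I[OF \<Delta> W, of "{y1, y2}" ?R "{y1, y2}"]) auto
qed

text \<open>With only one isolated vertex \<open>s\<close> involved, choosing \<open>y\<close> and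
  \<open>z\<close> gains 20 + 19 + 19 = 58; the bonuses of \<open>z\<close> and the four members of
  \<open>Q\<close> supply exactly the missing 30.\<close>

lemma good4_pair_same:
  assumes \<Delta>: "\<Delta> = 4" and W: "state W" and le2: "\<And>w. w \<in> W \<Longrightarrow> dg W w \<le> 2"
    and u: "N u1 \<inter> W = {u2}" "N u2 \<inter> W = {u1}"
    and z: "z \<in> V - W" "u1 \<in> N z" "s \<notin> N z" and y: "y \<in> V - W" "N y \<inter> W = {s, u2}"
    and s: "s \<in> isolated W"
    and Q: "Q \<subseteq> V - W" "card Q = 4" "\<And>q. q \<in> Q \<Longrightarrow> s \<in> N q \<and> N q \<inter> W \<subseteq> {s, u1, u2}"
  shows "good4 W"
proof -
  let ?R = "{s, u1, u2} \<union> (N z \<inter> W)"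
  have uW: "u1 \<in> W" "u2 \<in> W" "s \<in> W" using u s isolated_subset by auto
  have "u2 \<in> N u1" using u by blast
  then have ne: "u1 \<noteq> u2" using N_irrefl by auto
  have ne': "s \<noteq> u1" "s \<noteq> u2" using isolated_N[OF s] u by auto
  have g: "gain4 W ?R u1 = 19" "gain4 W ?R u2 = 19"
    using u by (subst gain4_inner; auto simp: dg_def)+
  have "(\<Sum>r\<in>{s, u1, u2}. gain4 W ?R r) \<le> (\<Sum>r\<in>?R. gain4 W ?R r)"
  proof (rule sum_mono2)
    fix r assume "r \<in> ?R - {s, u1, u2}"
    then show "0 \<le> gain4 W ?R r" using gain4_ge[OF le2, of r ?R] by auto
  qed auto
  then have sum: "58 \<le> (\<Sum>r\<in>?R. gain4 W ?R r)"
    using g ne ne' s by (simp add: gain4_isolated)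
  have "finite Q" using Q(2) card.infinite by fastforce
  moreover have "z \<notin> Q" using Q(3) z(3) by auto
  ultimately have card: "card (insert z Q) = 5" using Q(2) by simp
  have "y \<noteq> z" using y z by auto
  moreover have "W \<inter> reach {y, z} = ?R"
    using y z uW by (auto simp: reach_def)
  moreover have "N q \<inter> W \<noteq> {} \<and> N q \<inter> W \<subseteq> ?R" if "q \<in> insert z Q" for q
    using that Q(3) z(2) uW by auto
  ultimately show ?thesis
    using y(1) z(1) sum card Q(1)
    by (intro good4I[OF \<Delta> W, of "{y, z}" ?R "insert z Q"]) auto
qed

text \<open>A maximal independent set dominates \<open>U\<close> by maximality. So does its
  complement in \<open>U\<close>, because each independent vertex has a neighbour in
  \<open>U\<close>, which cannot be independent of it. The smaller of the two is taken.\<close>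

lemma half_domination:
  assumes "U \<subseteq> V" and nonisolated: "\<And>u. u \<in> U \<Longrightarrow> N u \<inter> U \<noteq> {}"
  shows "\<exists>D\<subseteq>U. U \<subseteq> reach D \<and> 2 * card D \<le> card U"
proof -
  define Ind where "Ind = {I. I \<subseteq> U \<and> (\<forall>v\<in>I. N v \<inter> I = {})}"
  have fin: "finite U" using assms(1) finite_V finite_subset by blast
  then have "finite Ind" "{} \<in> Ind" by (auto simp: Ind_def)
  then obtain I where I: "I \<in> Ind" and I_max: "\<And>J. J \<in> Ind \<Longrightarrow> I \<subseteq> J \<Longrightarrow> J = I"
    using finite_has_maximal2[of Ind "{}"] by metis
  have dom1: "U \<subseteq> reach I"
  proof
    fix u assume u: "u \<in> U"
    show "u \<in> reach I"
    proof (rule ccontr)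
      assume not_reached: "u \<notin> reach I"
      then have "N u \<inter> I = {}" using N_sym by (auto simp: reach_def)
      then have "insert u I \<in> Ind"
        using I u not_reached N_irrefl by (auto simp: reach_def Ind_def)
      then have "insert u I = I" using I_max by blast
      then show False using not_reached by (auto simp: reach_def)
    qed
  qed
  have dom2: "U \<subseteq> reach (U - I)"
  proof
    fix u assume u: "u \<in> U"
    show "u \<in> reach (U - I)"
    proof (cases "u \<in> I")
      case True
      obtain w where "w \<in> N u" "w \<in> U" using nonisolated[OF u] by blast
      moreover have "w \<notin> I" using I True \<open>w \<in> N u\<close> by (auto simp: Ind_def)
      ultimately show ?thesis using N_sym by (auto simp: reach_def)
    qed (use u in \<open>auto simp: reach_def\<close>)
  qed
  have "I \<subseteq> U" using I by (simp add: Ind_def)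
  then have "card I + card (U - I) = card U"
    using fin card_mono[of U I] finite_subset[of I U] by (simp add: card_Diff_subset)
  then have "2 * card I \<le> card U \<or> 2 * card (U - I) \<le> card U" by linarith
  then show ?thesis using \<open>I \<subseteq> U\<close> dom1 dom2 by (metis Diff_subset)
qed

definition unshared_N :: "'a set \<Rightarrow> 'a \<Rightarrow> 'a set" where
  "unshared_N W w = {y \<in> N w - W. \<not> shared W y}"

text \<open>Otherwise choosing \<open>y\<close> would be a step, by
  \<open>good4_outside\<close>.\<close>

lemma shared_cases:
  assumes \<Delta>: "\<Delta> = 4" and W: "state W" and le2: "\<And>w. w \<in> W \<Longrightarrow> dg W w \<le> 2"
    and ng: "\<not> good4 W" and y: "y \<in> V - W" "shared W y"
  obtains s where "s \<in> isolated W" "s \<in> N y" "N y \<inter> isolated W = {s}" "card (N y \<inter> W) \<le> 2"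
proof -
  obtain s where s: "s \<in> N y \<inter> isolated W" using y(2) by (auto simp: shared_def)
  have "\<not> 3 \<le> card (N y \<inter> W)" "\<forall>s'\<in>N y \<inter> isolated W. s' = s"
    using good4_outside[OF \<Delta> W le2 y(1) s] ng by blast+
  moreover from this have "N y \<inter> isolated W = {s}" using s by blast
  ultimately show ?thesis using that[of s] IntD1[OF s] IntD2[OF s] by simp
qed

lemma shared_N_eq:
  assumes \<Delta>: "\<Delta> = 4" and W: "state W" and le2: "\<And>w. w \<in> W \<Longrightarrow> dg W w \<le> 2"
    and ng: "\<not> good4 W" and y: "y \<in> V - W" "shared W y"
    and u: "u \<in> N y" "u \<in> W" "u \<notin> isolated W"
  obtains s where "s \<in> isolated W" "N y \<inter> W = {s, u}"
proof -
  obtain s where s: "s \<in> isolated W" "s \<in> N y" "card (N y \<inter> W) \<le> 2"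
    using shared_cases[OF \<Delta> W le2 ng y] by metis
  have "s \<noteq> u" using s u by auto
  then have "{s, u} = N y \<inter> W"
    using s u isolated_subset by (intro card_seteq) auto
  then show ?thesis using that s by metis
qed

text \<open>Each end of the edge has three outside neighbours. If fewer than three of the six
  incidences were unshared, both ends would have shared neighbours, all using the same isolated
  \<open>s\<close> by \<open>good4_pair\<close>. These are at least four distinct neighbours of
  \<open>s\<close>, hence exactly four, and a remaining unshared neighbour allows
  \<open>good4_pair_same\<close>.\<close>

lemma unshared_pair:
  assumes \<Delta>: "\<Delta> = 4" and W: "state W" and le2: "\<And>w. w \<in> W \<Longrightarrow> dg W w \<le> 2"
    and ng: "\<not> good4 W" and u: "N u1 \<inter> W = {u2}" "N u2 \<inter> W = {u1}"
  shows "3 \<le> card (unshared_N W u1) + card (unshared_N W u2)"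
proof (rule ccontr)
  assume few: "\<not> ?thesis"
  define Sh where "Sh u = {y \<in> N u - W. shared W y}" for u
  have uW: "u1 \<in> W" "u2 \<in> W" using u by auto
  have not_iso: "u1 \<notin> isolated W" "u2 \<notin> isolated W" using isolated_N u by blast+
  have "u2 \<in> N u1" using u by blast
  then have ne: "u1 \<noteq> u2" using N_irrefl by auto
  have fin: "finite (Sh w)" "finite (unshared_N W w)" for w
    by (auto simp: Sh_def unshared_N_def)
  have card3: "card (Sh w) + card (unshared_N W w) = 3" if "w \<in> {u1, u2}" for w
  proof -
    have "dg W w = 1" using that u by (auto simp: dg_def)
    then have "card (N w - W) = 3" using dg_outside[OF W, of w] that uW \<Delta> by auto
    moreover have "N w - W = Sh w \<union> unshared_N W w" by (auto simp: Sh_def unshared_N_def)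
    moreover have "card (Sh w \<union> unshared_N W w) = card (Sh w) + card (unshared_N W w)"
      using fin by (intro card_Un_disjoint) (auto simp: Sh_def unshared_N_def)
    ultimately show ?thesis by simp
  qed
  have c: "card (Sh u1) + card (unshared_N W u1) = 3" "card (Sh u2) + card (unshared_N W u2) = 3"
    using card3 by auto
  have Sh_V: "y \<in> V - W \<and> shared W y \<and> w \<in> N y" if "y \<in> Sh w" for y w
    using that N_subset[of w] N_sym by (auto simp: Sh_def)
  have form1: "\<exists>s\<in>isolated W. N y \<inter> W = {s, u1}" if "y \<in> Sh u1" for y
    using shared_N_eq[OF \<Delta> W le2 ng, of y u1] Sh_V[OF that] uW not_iso by metis
  have form2: "\<exists>s\<in>isolated W. N y \<inter> W = {s, u2}" if "y \<in> Sh u2" for y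
    using shared_N_eq[OF \<Delta> W le2 ng, of y u2] Sh_V[OF that] uW not_iso by metis
  have same: "s1 = s2" if "y1 \<in> Sh u1" "N y1 \<inter> W = {s1, u1}" "s1 \<in> isolated W"
    "y2 \<in> Sh u2" "N y2 \<inter> W = {s2, u2}" "s2 \<in> isolated W" for y1 y2 s1 s2
    using good4_pair[OF \<Delta> W u _ that(2) _ that(5,3,6)] Sh_V[OF that(1)] Sh_V[OF that(4)] ng
    by blast
  have "Sh u1 \<noteq> {}" "Sh u2 \<noteq> {}"
    using few c by (metis add_cancel_left_left card.empty le_add1 le_add2)+
  then obtain y1 y2 where y: "y1 \<in> Sh u1" "y2 \<in> Sh u2" by blast
  obtain s where s: "s \<in> isolated W" "N y2 \<inter> W = {s, u2}" using form2[OF y(2)] by blast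
  have all1: "N q \<inter> W = {s, u1}" if "q \<in> Sh u1" for q
    using form1[OF that] same[OF that _ _ y(2) s(2,1)] by blast
  have all2: "N q \<inter> W = {s, u2}" if "q \<in> Sh u2" for q
    using form2[OF that] same[OF y(1) all1[OF y(1)] s(1) that] by blast
  have s_ne: "s \<noteq> u1" "s \<noteq> u2" using s not_iso by auto
  define Q where "Q = Sh u1 \<union> Sh u2"
  have Q: "Q \<subseteq> V - W" "\<And>q. q \<in> Q \<Longrightarrow> s \<in> N q \<and> N q \<inter> W \<subseteq> {s, u1, u2}"
    using Sh_V all1 all2 unfolding Q_def by blast+
  have "q \<notin> Sh u2" if "q \<in> Sh u1" for q using all1[OF that] all2[of q] ne s_ne by auto
  then have "Sh u1 \<inter> Sh u2 = {}" by auto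
  then have card_Q: "card Q = card (Sh u1) + card (Sh u2)"
    unfolding Q_def using fin by (intro card_Un_disjoint)
  have "Q \<subseteq> N s" using Q(2) N_sym by blast
  then have "card Q \<le> card (N s)" by (intro card_mono) auto
  then have "card Q \<le> 4" using card_N_le[of s] \<Delta> by simp
  then have Q4: "card Q = 4" "card (unshared_N W u1) + card (unshared_N W u2) = 2"
    using few c card_Q by linarith+
  have z: "z \<in> V - W \<and> w \<in> N z \<and> s \<notin> N z" if "z \<in> unshared_N W w" for z w
    using that s(1) N_subset[of w] N_sym by (auto simp: unshared_N_def shared_def)
  have "unshared_N W u1 \<noteq> {} \<or> unshared_N W u2 \<noteq> {}"
    using Q4(2) by auto
  then show False
  proof
    assume "unshared_N W u1 \<noteq> {}"
    then obtain z' where "z' \<in> unshared_N W u1" by blast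
    then have "z' \<in> V - W" "u1 \<in> N z'" "s \<notin> N z'" using z by blast+
    moreover have "y2 \<in> V - W" using Sh_V[OF y(2)] by simp
    ultimately show False
      using good4_pair_same[OF \<Delta> W le2 u _ _ _ _ s(2,1) Q(1) Q4(1) Q(2)] ng by simp
  next
    assume "unshared_N W u2 \<noteq> {}"
    then obtain z' where "z' \<in> unshared_N W u2" by blast
    then have "z' \<in> V - W" "u2 \<in> N z'" "s \<notin> N z'" using z by blast+
    moreover have "y1 \<in> V - W" using Sh_V[OF y(1)] by simp
    moreover have "s \<in> N q \<and> N q \<inter> W \<subseteq> {s, u2, u1}" if "q \<in> Q" for q
      using Q(2)[OF that] by blast
    ultimately show False
      using good4_pair_same[OF \<Delta> W le2 u(2,1) _ _ _ _ all1[OF y(1)] s(1) Q(1) Q4(1)] ng by simp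
  qed
qed

text \<open>
  When no local step applies, all of \<open>W\<close> is dominated at once, by its isolated vertices and half of
  the others. This is paid for by letting every outside vertex distribute its bonus \<open>6\<close>: all of it to
  its isolated neighbour if there is one, and otherwise \<open>2\<close> to each of its at most three neighbours.
\<close>
lemma good4_count:
  assumes \<Delta>: "\<Delta> = 4" and W: "state W" "W \<noteq> {}" and le2: "\<And>w. w \<in> W \<Longrightarrow> dg W w \<le> 2"
    and deg1: "\<And>u w. u \<in> W \<Longrightarrow> dg W u = 1 \<Longrightarrow> w \<in> N u \<inter> W \<Longrightarrow> dg W w = 1"
    and deg2: "\<And>w y. w \<in> W \<Longrightarrow> dg W w = 2 \<Longrightarrow> y \<in> N w - W \<Longrightarrow> \<not> shared W y"
    and ng: "\<not> good4 W"
  shows False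
proof -
  have WV: "W \<subseteq> V" "finite W" using state_subset state_finite W(1) by auto
  define S0 S1 S2 where "S0 = isolated W" and "S1 = {w \<in> W. dg W w = 1}"
    and "S2 = {w \<in> W. dg W w = 2}"
  have "dg W w = 0 \<or> dg W w = 1 \<or> dg W w = 2" if "w \<in> W" for w
    using le2[OF that] by linarith
  then have W_eq: "W = S0 \<union> (S1 \<union> S2)"
    unfolding S0_def S1_def S2_def isolated_def by blast
  have S: "S0 \<inter> (S1 \<union> S2) = {}" "S1 \<inter> S2 = {}" "finite S0" "finite S1" "finite S2"
    using WV(2) unfolding S0_def S1_def S2_def isolated_def by auto
  have sum_W: "(\<Sum>w\<in>W. h w) = (\<Sum>w\<in>S0. h w) + (\<Sum>w\<in>S1. h w) + (\<Sum>w\<in>S2. h w)"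
    for h :: "'a \<Rightarrow> int"
    using S by (subst W_eq, simp add: sum.union_disjoint)
  define A where "A = {y \<in> V - W. N y \<inter> W \<noteq> {}}"
  define charge where
    "charge w y = (if shared W y then (if w \<in> S0 then 6 else 0) else 2 :: int)" for w y
  have finA: "finite A" unfolding A_def using finite_V by auto

  have A_N: "N w - W = {y. y \<in> A \<and> y \<in> N w}" if "w \<in> W" for w
    using that N_subset[of w] N_sym unfolding A_def by blast
  have "(\<Sum>w\<in>W. \<Sum>y\<in>N w - W. charge w y) = (\<Sum>w\<in>W. \<Sum>y | y \<in> A \<and> y \<in> N w. charge w y)"
    using A_N by (intro sum.cong) auto
  also have "\<dots> = (\<Sum>y\<in>A. \<Sum>w | w \<in> W \<and> y \<in> N w. charge w y)"
    using WV finA by (intro sum.swap_restrict)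
  also have "\<dots> \<le> (\<Sum>y\<in>A. 6)"
  proof (rule sum_mono)
    fix y assume "y \<in> A"
    then have y: "y \<in> V - W" by (simp add: A_def)
    have eq: "{w. w \<in> W \<and> y \<in> N w} = N y \<inter> W" using N_commute by auto
    show "(\<Sum>w | w \<in> W \<and> y \<in> N w. charge w y) \<le> 6"
    proof (cases "shared W y")
      case True
      obtain s where "N y \<inter> S0 = {s}"
        using shared_cases[OF \<Delta> W(1) le2 ng y True] unfolding S0_def by metis
      moreover have "N y \<inter> W \<inter> S0 = N y \<inter> S0" using W_eq by auto
      moreover have "(\<Sum>w\<in>N y \<inter> W. charge w y) = (\<Sum>w\<in>N y \<inter> W \<inter> S0. 6)"
        unfolding sum.inter_restrict[OF finite_Int[OF disjI1[OF finite_N]]] charge_def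
        using True by simp
      ultimately show ?thesis unfolding eq by simp
    next
      case False
      have "card (N y \<inter> W) \<le> 3"
        using state_dg_less[OF W(1) y] unfolding \<Delta> by (simp add: dg_def)
      then show ?thesis unfolding eq charge_def using False by simp
    qed
  qed
  finally have charge_le: "(\<Sum>w\<in>W. \<Sum>y\<in>N w - W. charge w y) \<le> 6 * int (card A)" by simp

  have ch0: "(\<Sum>y\<in>N w - W. charge w y) = 24" if "w \<in> S0" for w
  proof -
    have "shared W y" if "y \<in> N w - W" for y
      using that \<open>w \<in> S0\<close> N_sym by (auto simp: shared_def S0_def)
    then have "(\<Sum>y\<in>N w - W. charge w y) = (\<Sum>y\<in>N w - W. 6)"
      using that by (intro sum.cong) (auto simp: charge_def)
    moreover have "card (N w - W) = 4"
      using dg_outside[OF W(1), of w] that \<Delta> by (auto simp: S0_def isolated_def)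
    ultimately show ?thesis by simp
  qed
  have ch1: "(\<Sum>y\<in>N w - W. charge w y) = 2 * int (card (unshared_N W w))" if "w \<in> S1" for w
  proof -
    have "w \<notin> S0" using that S by auto
    then have "(\<Sum>y\<in>N w - W. charge w y) = (\<Sum>y\<in>N w - W. if y \<in> - Collect (shared W) then 2 else 0)"
      by (intro sum.cong) (auto simp: charge_def)
    also have "\<dots> = (\<Sum>y\<in>(N w - W) \<inter> - Collect (shared W). 2)"
      by (rule sum.inter_restrict[symmetric]) auto
    also have "(N w - W) \<inter> - Collect (shared W) = unshared_N W w"
      by (auto simp: unshared_N_def)
    finally show ?thesis by simp
  qed
  have ch2: "(\<Sum>y\<in>N w - W. charge w y) = 4" if "w \<in> S2" for w
  proof -
    have "(\<Sum>y\<in>N w - W. charge w y) = (\<Sum>y\<in>N w - W. 2)"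
      using that deg2 by (intro sum.cong) (auto simp: charge_def S2_def)
    moreover have "card (N w - W) = 2"
      using dg_outside[OF W(1), of w] that \<Delta> by (auto simp: S2_def)
    ultimately show ?thesis by simp
  qed

  define mate where "mate u = (THE w. N u \<inter> W = {w})" for u
  have mate: "N u \<inter> W = {mate u}" if "u \<in> S1" for u
  proof -
    obtain w where "N u \<inter> W = {w}"
      using \<open>u \<in> S1\<close> card_1_singletonE unfolding S1_def dg_def by blast
    then show ?thesis unfolding mate_def by auto
  qed
  have mate_S1: "mate u \<in> S1" if "u \<in> S1" for u
    using mate[OF that] that deg1[of u "mate u"] by (auto simp: S1_def)
  have mate_mate: "mate (mate u) = u" if "u \<in> S1" for u
  proof -
    have "u \<in> N (mate u) \<inter> W" using mate[OF that] that N_sym by (auto simp: S1_def)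
    then show ?thesis using mate[OF mate_S1[OF that]] by auto
  qed
  let ?t = "\<lambda>u. int (card (unshared_N W u))"
  \<comment> \<open>Reindexing along the involution \<open>mate\<close> turns the bound of
    \<open>unshared_pair\<close> into an average of at least 3/2 unshared neighbours per vertex of
    \<open>S1\<close>.\<close>
  have "(\<Sum>u\<in>S1. ?t (mate u)) = (\<Sum>u\<in>S1. ?t u)"
    using mate_S1 mate_mate
    by (intro sum.reindex_bij_witness[of _ mate mate]) auto
  moreover have "(\<Sum>u\<in>S1. 3) \<le> (\<Sum>u\<in>S1. ?t u + ?t (mate u))"
  proof (rule sum_mono)
    fix u assume "u \<in> S1"
    then have "N u \<inter> W = {mate u}" "N (mate u) \<inter> W = {u}"
      using mate mate_S1 mate_mate by metis+
    from unshared_pair[OF \<Delta> W(1) le2 ng this] show "3 \<le> ?t u + ?t (mate u)" by linarith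
  qed
  ultimately have t: "3 * int (card S1) \<le> 2 * (\<Sum>u\<in>S1. ?t u)" by (simp add: sum.distrib)

  have "(\<Sum>w\<in>W. \<Sum>y\<in>N w - W. charge w y)
      = 24 * int (card S0) + 2 * (\<Sum>u\<in>S1. ?t u) + 4 * int (card S2)"
    unfolding sum_W by (simp add: ch0 ch1 ch2 sum_distrib_left)
  then have A_ge: "24 * int (card S0) + 3 * int (card S1) + 4 * int (card S2) \<le> 6 * int (card A)"
    using t charge_le by linarith
  have "(\<Sum>r\<in>W. gain4 W W r) = (\<Sum>r\<in>W. 20 - int (dg W r))"
    by (intro sum.cong gain4_inner) auto
  also have "\<dots> = 20 * int (card S0) + 19 * int (card S1) + 18 * int (card S2)"
    unfolding sum_W by (simp add: S0_def isolated_def S1_def S2_def)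
  \<comment> \<open>Gain plus received charge is 20 + 24 = 44 per isolated vertex, and at least 19 +
    3 = 22 on average on \<open>S1\<close> and 18 + 4 = 22 on \<open>S2\<close>: enough to choose
    all of \<open>S0\<close> and half of the rest.\<close>
  finally have gain: "(\<Sum>r\<in>W. gain4 W W r) + 6 * int (card A)
      \<ge> 44 * int (card S0) + 22 * int (card S1) + 22 * int (card S2)"
    using A_ge by linarith

  have "N u \<inter> (S1 \<union> S2) \<noteq> {}" if u: "u \<in> S1 \<union> S2" for u
  proof -
    obtain w where w: "w \<in> N u" "w \<in> W"
      using u by (auto simp: S1_def S2_def dg_def dest!: card_eq_SucD simp: numeral_2_eq_2)
    have "u \<in> N w \<inter> W" using N_sym[OF w(1)] u W_eq by auto
    then have "w \<notin> S0" using isolated_N unfolding S0_def by blast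
    then show ?thesis using w W_eq by auto
  qed
  then obtain D where D: "D \<subseteq> S1 \<union> S2" "S1 \<union> S2 \<subseteq> reach D" "2 * card D \<le> card (S1 \<union> S2)"
    using half_domination[of "S1 \<union> S2"] W_eq WV by blast
  have "card (S1 \<union> S2) = card S1 + card S2" using S by (intro card_Un_disjoint)
  moreover have "card (S0 \<union> D) \<le> card S0 + card D" by (rule card_Un_le)
  ultimately have "44 * int (card (S0 \<union> D)) \<le> (\<Sum>r\<in>W. gain4 W W r) + 6 * int (card A)"
    using gain D(3) by linarith
  moreover have "W \<inter> reach (S0 \<union> D) = W" using D(2) W_eq by (auto simp: reach_def)
  ultimately have "good4 W"
    using W D(1) W_eq WV by (intro good4I[OF \<Delta> W(1), of "S0 \<union> D" W A]) (auto simp: A_def)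
  then show False using ng by simp
qed

lemma good4:
  assumes \<Delta>: "\<Delta> = 4" and W: "state W" "W \<noteq> {}"
  shows "good4 W"
proof (rule ccontr)
  assume ng: "\<not> good4 W"
  have le2: "dg W w \<le> 2" if "w \<in> W" for w
    using good4_large_degree[OF \<Delta> W(1) that] ng by force
  show False
  proof (rule good4_count[OF \<Delta> W le2 _ _ ng])
    fix u w assume u: "u \<in> W" "dg W u = 1" "w \<in> N u \<inter> W"
    then have w: "w \<in> W" "u \<in> N w" using N_sym by auto
    then have "dg W w \<noteq> 0" using u by (auto simp: dg_eq_0_iff)
    moreover have "dg W w \<noteq> 2" using good4_path_end[OF \<Delta> W(1) w(1) _ w(2) u(1,2) le2] ng by blast
    ultimately show "dg W w = 1" using le2[OF w(1)] by linarith
  next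
    fix w y assume w: "w \<in> W" "dg W w = 2" and y: "y \<in> N w - W"
    show "\<not> shared W y"
    proof
      assume sh: "shared W y"
      have yV: "y \<in> V - W" and wy: "w \<in> N y" using y N_subset[of w] N_sym by auto
      obtain s where s: "s \<in> isolated W" "N y \<inter> W = {s, w}"
        using shared_N_eq[OF \<Delta> W(1) le2 ng yV sh wy w(1)] w by (auto simp: isolated_def)
      obtain u x z where "N w \<inter> W = {u, x}" "N u \<inter> W = {w, z}" "N x \<inter> W = {w, z}"
        "N z \<inter> W = {u, x}" "u \<noteq> x" "w \<noteq> z"
        using good4_or_square[OF \<Delta> W(1) le2 ng w] .
      from good4_square[OF \<Delta> W(1) le2 yV s(2,1) this] show False using ng by simp
    qed
  qed
qed

lemma domination4:
  assumes "\<Delta> = 4"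
  shows "\<exists>D\<subseteq>V. full \<subseteq> reach D \<and> 11 * card D \<le> 4 * card V"
proof -
  have "\<exists>D\<subseteq>V. full \<subseteq> reach D \<and> 44 * int (card D) \<le> pot 16 weight4 full"
    using good4[OF assms]
    by (intro domination_by_potential state_full) (auto simp: weight4_def good4_def)
  then obtain D where "D \<subseteq> V" "full \<subseteq> reach D" "44 * int (card D) \<le> pot 16 weight4 full"
    by blast
  moreover have "pot 16 weight4 full \<le> 16 * int (card V)"
    using assms by (intro pot_full_le) (auto simp: weight4_def)
  ultimately show ?thesis by (intro exI[of _ D]) simp
qed

end

section \<open>Deleting vertices from a graph\<close>

text \<open>The inequality excludes loops, since \<open>{v, v}\<close> is the singleton of
  \<open>v\<close>; thus \<open>adj\<close> is irreflexive for every \<open>E\<close>.\<close>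

definition adj :: "'a set set \<Rightarrow> 'a \<Rightarrow> 'a set" where
  "adj E v = {u. {u, v} \<in> E \<and> u \<noteq> v}"

definition deletion :: "'a set \<Rightarrow> 'a set set \<Rightarrow> nat \<Rightarrow> 'a set \<Rightarrow> bool" where
  "deletion V E k D \<longleftrightarrow> D \<subseteq> V \<and> (\<forall>v\<in>V - D. vertex_degree (induced_edges E (V - D)) v \<le> k)"

lemma finite_edges: "simple_graph V E \<Longrightarrow> finite E"
  unfolding simple_graph_def by (meson PowI finite_Pow_iff finite_subset subsetI)

lemma max_degree_le_iff:
  "finite V \<Longrightarrow> max_degree V E \<le> k \<longleftrightarrow> (\<forall>v\<in>V. vertex_degree E v \<le> k)"
  by (simp add: max_degree_def)

lemma simple_graph_induced:
  "simple_graph V E \<Longrightarrow> I \<subseteq> V \<Longrightarrow> simple_graph I (induced_edges E I)"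
  by (auto simp: simple_graph_def induced_edges_def intro: finite_subset)

lemma induced_edges_induced:
  "J \<subseteq> I \<Longrightarrow> induced_edges (induced_edges E I) J = induced_edges E J"
  by (auto simp: induced_edges_def)

lemma vertex_degree_eq:
  assumes "simple_graph V E"
  shows "vertex_degree E v = card (adj E v)"
proof -
  have "{e \<in> E. v \<in> e} = (\<lambda>u. {u, v}) ` adj E v"
  proof (intro equalityI subsetI)
    fix e assume e: "e \<in> {e \<in> E. v \<in> e}"
    then obtain a b where "e = {a, b}" "a \<noteq> b"
      using assms by (auto simp: simple_graph_def card_2_iff)
    then obtain u where "e = {u, v}" "u \<noteq> v" using e by auto
    then show "e \<in> (\<lambda>u. {u, v}) ` adj E v" using e by (auto simp: adj_def)
  qed (auto simp: adj_def)
  moreover have "inj_on (\<lambda>u. {u, v}) (adj E v)"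
    by (auto simp: inj_on_def adj_def doubleton_eq_iff)
  ultimately show ?thesis by (simp add: vertex_degree_def card_image)
qed

lemma adj_induced: "v \<in> I \<Longrightarrow> adj (induced_edges E I) v = adj E v \<inter> I"
  by (auto simp: adj_def induced_edges_def)

lemma adj_subset: "simple_graph V E \<Longrightarrow> adj E v \<subseteq> V"
  by (auto simp: simple_graph_def adj_def)

lemma handshake:
  assumes "simple_graph V E" and k: "\<forall>v\<in>V. vertex_degree E v \<le> k"
  shows "2 * card E \<le> k * card V"
proof -
  have fin: "finite V" "finite E" using assms finite_edges by (auto simp: simple_graph_def)
  have "2 * card E = (\<Sum>e\<in>E. card {v. v \<in> V \<and> v \<in> e})"
  proof -
    have "card {v. v \<in> V \<and> v \<in> e} = 2" if "e \<in> E" for e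
    proof -
      have "{v. v \<in> V \<and> v \<in> e} = e" using assms(1) that by (auto simp: simple_graph_def)
      then show ?thesis using assms(1) that by (simp add: simple_graph_def)
    qed
    then show ?thesis by simp
  qed
  also have "\<dots> = (\<Sum>v\<in>V. vertex_degree E v)"
    unfolding vertex_degree_def using fin sum.swap_restrict[of E V "\<lambda>_ _. 1 :: nat" "\<lambda>e v. v \<in> e"]
    by simp
  also have "\<dots> \<le> (\<Sum>v\<in>V. k)" using k by (intro sum_mono) auto
  finally show ?thesis by (simp add: mult.commute)
qed

lemma deletion_union:
  assumes "deletion V E j D" "deletion (V - D) (induced_edges E (V - D)) k D'"
  shows "deletion V E k (D \<union> D')"
proof -
  have "V - D - D' = V - (D \<union> D')" by auto
  moreover have "induced_edges (induced_edges E (V - D)) (V - (D \<union> D'))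
      = induced_edges E (V - (D \<union> D'))"
    by (intro induced_edges_induced) auto
  ultimately show ?thesis using assms unfolding deletion_def by auto
qed

text \<open>Every deleted vertex takes at least \<open>Suc k\<close> edges with it. The surviving
  edges stay in the bound so that a second deletion can be charged to them.\<close>

lemma greedy_deletion:
  assumes "simple_graph V E"
  shows "\<exists>D. deletion V E k D \<and> Suc k * card D + card (induced_edges E (V - D)) \<le> card E"
  using assms
proof (induction "card V" arbitrary: V E rule: less_induct)
  case less
  note sg = less.prems
  have finV: "finite V" using sg by (simp add: simple_graph_def)
  have finE: "finite E" using sg by (rule finite_edges)
  show ?case
  proof (cases "\<forall>v\<in>V. vertex_degree E v \<le> k")
    case True
    have "induced_edges E V = E" using sg by (auto simp: simple_graph_def induced_edges_def)
    then show ?thesis using True by (intro exI[of _ "{}"]) (simp add: deletion_def)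
  next
    case False
    then obtain v where v: "v \<in> V" "Suc k \<le> vertex_degree E v" by force
    let ?V = "V - {v}"
    let ?E = "induced_edges E ?V"
    have "card ?V < card V" using v(1) finV by (intro psubset_card_mono) auto
    from less.hyps[OF this simple_graph_induced[OF sg, of ?V]]
    obtain D where D: "deletion ?V ?E k D"
      "Suc k * card D + card (induced_edges ?E (?V - D)) \<le> card ?E" by auto
    have "E = ?E \<union> {e \<in> E. v \<in> e}"
      using sg by (auto simp: simple_graph_def induced_edges_def)
    moreover have "card (?E \<union> {e \<in> E. v \<in> e}) = card ?E + vertex_degree E v"
      unfolding vertex_degree_def using finE
      by (intro card_Un_disjoint) (auto simp: induced_edges_def)
    ultimately have card_E: "card E = card ?E + vertex_degree E v" by simp
    have D_sub: "D \<subseteq> ?V" using D(1) by (simp add: deletion_def)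
    have V_eq: "?V - D = V - insert v D" by auto
    have E_eq: "induced_edges ?E (V - insert v D) = induced_edges E (V - insert v D)"
      by (intro induced_edges_induced) auto
    have "card (insert v D) = Suc (card D)"
      using D_sub finV by (intro card_insert_disjoint) (auto intro: finite_subset)
    then show ?thesis
      using D D_sub v card_E unfolding deletion_def V_eq E_eq
      by (intro exI[of _ "insert v D"]) auto
  qed
qed

text \<open>A surviving vertex of degree \<Delta> has a neighbour in the dominating set
  \<open>D\<close> and loses it; all other vertices have smaller degree from the start.\<close>

lemma
  assumes sg: "simple_graph V E" and deg: "\<forall>v\<in>V. vertex_degree E v \<le> \<Delta>" and "\<Delta> > 0"
  shows bounded_degree_graph_adj: "bounded_degree_graph V (adj E) \<Delta>"
    and deletion_dominating:
      "D \<subseteq> V \<Longrightarrow> bounded_degree_graph.full V (adj E) \<Delta> \<subseteq> bounded_degree_graph.reach (adj E) D \<Longrightarrow>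
        deletion V E (\<Delta> - 1) D"
proof -
  show *: "bounded_degree_graph V (adj E) \<Delta>"
  proof
    show "finite V" using sg by (simp add: simple_graph_def)
    show "adj E v \<subseteq> V" for v using adj_subset[OF sg] .
    show "u \<in> adj E v \<Longrightarrow> v \<in> adj E u" for u v by (auto simp: adj_def insert_commute)
    show "v \<notin> adj E v" for v by (simp add: adj_def)
    show "card (adj E v) \<le> \<Delta>" for v
    proof (cases "v \<in> V")
      case True
      then show ?thesis using deg vertex_degree_eq[OF sg] by metis
    next
      case False
      then have "adj E v = {}" using sg by (auto simp: simple_graph_def adj_def)
      then show ?thesis by simp
    qed
  qed fact
  interpret bounded_degree_graph V "adj E" \<Delta> by (rule *)
  assume D: "D \<subseteq> V" "full \<subseteq> reach D"
  have "vertex_degree (induced_edges E (V - D)) v \<le> \<Delta> - 1" if v: "v \<in> V - D" for v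
  proof -
    have "card (adj E v \<inter> (V - D)) < \<Delta>"
    proof (cases "v \<in> full")
      case True
      then obtain s where "s \<in> D" "s \<in> adj E v" using D v N_sym by (auto simp: reach_def)
      then have "card (adj E v \<inter> (V - D)) < card (adj E v)"
        by (intro psubset_card_mono) auto
      then show ?thesis using card_N_le[of v] by simp
    next
      case False
      then have "card (adj E v) < \<Delta>" using card_N_le[of v] v by (auto simp: full_def)
      moreover have "card (adj E v \<inter> (V - D)) \<le> card (adj E v)" by (intro card_mono) auto
      ultimately show ?thesis by simp
    qed
    then show ?thesis
      using vertex_degree_eq[OF simple_graph_induced[OF sg, of "V - D"], of v] adj_induced[OF v]
      by auto
  qed
  then show "deletion V E (\<Delta> - 1) D" using D by (simp add: deletion_def)
qed

section \<open>Deletion bounds for target degrees 3 and 4\<close>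

lemma deletion_to_3:
  assumes sg: "simple_graph V E" and "\<forall>v\<in>V. vertex_degree E v \<le> 4"
  shows "\<exists>D. deletion V E 3 D \<and> 11 * card D \<le> 4 * card V"
proof -
  interpret bounded_degree_graph V "adj E" 4
    using assms by (intro bounded_degree_graph_adj) auto
  obtain D where "D \<subseteq> V" "full \<subseteq> reach D" "11 * card D \<le> 4 * card V"
    using domination4 by blast
  then show ?thesis using deletion_dominating[of V E 4 D] assms by auto
qed

lemma deletion_to_4:
  assumes sg: "simple_graph V E" and "\<forall>v\<in>V. vertex_degree E v \<le> 5"
  shows "\<exists>D. deletion V E 4 D \<and> 14 * card D \<le> 5 * card V"
proof -
  interpret bounded_degree_graph V "adj E" 5
    using assms by (intro bounded_degree_graph_adj) auto
  obtain D where "D \<subseteq> V" "full \<subseteq> reach D" "14 * card D \<le> 5 * card V"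
    using domination5 by blast
  then show ?thesis using deletion_dominating[of V E 5 D] assms by auto
qed

lemma
  assumes sg: "simple_graph V E" and D: "deletion V E j D"
  shows simple_graph_deletion: "simple_graph (V - D) (induced_edges E (V - D))"
    and degree_deletion: "\<forall>v\<in>V - D. vertex_degree (induced_edges E (V - D)) v \<le> j"
    and card_deletion: "card (V - D) + card D = card V"
proof -
  have "finite V" "D \<subseteq> V" using sg D by (auto simp: simple_graph_def deletion_def)
  then show "card (V - D) + card D = card V"
    using card_mono[of V D] finite_subset[of D V] by (simp add: card_Diff_subset)
qed (use sg D in \<open>auto simp: deletion_def intro: simple_graph_induced\<close>)

text \<open>
  After deleting greedily down to degree 4, the better of domination and greedy deletion is at most
  their convex combination with weights \<open>11/39\<close> and \<open>28/39\<close>; in \<open>deletion_any_to_4\<close> the weights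
  are \<open>14/59\<close> and \<open>45/59\<close>.
\<close>
lemma deletion_from_5_to_3:
  assumes sg: "simple_graph V E" and deg: "\<forall>v\<in>V. vertex_degree E v \<le> 5"
  shows "\<exists>D. deletion V E 3 D \<and> 39 * card D \<le> 4 * card V + 7 * card E"
proof -
  obtain D1 where D1: "deletion V E 4 D1"
    "5 * card D1 + card (induced_edges E (V - D1)) \<le> card E"
    using greedy_deletion[OF sg, of 4] by auto
  let ?V = "V - D1" and ?E = "induced_edges E (V - D1)"
  note sg1 = simple_graph_deletion[OF sg D1(1)]
  obtain D2 where D2: "deletion ?V ?E 3 D2" "11 * card D2 \<le> 4 * card ?V"
    using deletion_to_3[OF sg1 degree_deletion[OF sg D1(1)]] by blast
  obtain D3 where D3: "deletion ?V ?E 3 D3"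
    "4 * card D3 + card (induced_edges ?E (?V - D3)) \<le> card ?E"
    using greedy_deletion[OF sg1, of 3] by auto
  \<comment> \<open>Writing cardinalities as \<open>D1\<close>, \<open>V\<close> and so on, 11
    \<open>D2\<close> + 28 \<open>D3\<close> is at most 4 (\<open>V\<close> - \<open>D1\<close>) + 7
    (\<open>E\<close> - 5 \<open>D1\<close>), in which \<open>D1\<close> has total coefficient
    -39.\<close>
  have "39 * card D1 + 39 * card D2 \<le> 4 * card V + 7 * card E \<or>
      39 * card D1 + 39 * card D3 \<le> 4 * card V + 7 * card E"
    using D1(2) D2(2) D3(2) card_deletion[OF sg D1(1)] by linarith
  moreover have "card (D1 \<union> D2) \<le> card D1 + card D2" "card (D1 \<union> D3) \<le> card D1 + card D3"
    by (rule card_Un_le)+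
  ultimately have "39 * card (D1 \<union> D2) \<le> 4 * card V + 7 * card E \<or>
      39 * card (D1 \<union> D3) \<le> 4 * card V + 7 * card E" by linarith
  then show ?thesis using deletion_union[OF D1(1) D2(1)] deletion_union[OF D1(1) D3(1)] by blast
qed

lemma deletion_any_to_3:
  assumes sg: "simple_graph V E"
  shows "\<exists>D. deletion V E 3 D \<and> 39 * card D \<le> 9 * card V + 5 * card E"
proof -
  obtain D1 where D1: "deletion V E 5 D1"
    "6 * card D1 + card (induced_edges E (V - D1)) \<le> card E"
    using greedy_deletion[OF sg, of 5] by auto
  let ?V = "V - D1" and ?E = "induced_edges E (V - D1)"
  note sg1 = simple_graph_deletion[OF sg D1(1)] and deg1 = degree_deletion[OF sg D1(1)]
  obtain D2 where D2: "deletion ?V ?E 3 D2" "39 * card D2 \<le> 4 * card ?V + 7 * card ?E"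
    using deletion_from_5_to_3[OF sg1 deg1] by blast
  \<comment> \<open>Of the 7 copies of the remaining edge count, 5 are bounded by the greedy
    inequality and 2 by the handshake bound for degree 5. The coefficients of \<open>card D1\<close>
    then cancel: 39 = 4 + 30 + 5.\<close>
  have "39 * card D1 + 39 * card D2 \<le> 9 * card V + 5 * card E"
    using D1(2) D2(2) card_deletion[OF sg D1(1)] handshake[OF sg1 deg1] by linarith
  moreover have "card (D1 \<union> D2) \<le> card D1 + card D2" by (rule card_Un_le)
  ultimately have "39 * card (D1 \<union> D2) \<le> 9 * card V + 5 * card E" by linarith
  then show ?thesis using deletion_union[OF D1(1) D2(1)] by blast
qed

lemma deletion_any_to_4:
  assumes sg: "simple_graph V E"
  shows "\<exists>D. deletion V E 4 D \<and> 59 * card D \<le> 5 * card V + 9 * card E"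
proof -
  obtain D1 where D1: "deletion V E 5 D1"
    "6 * card D1 + card (induced_edges E (V - D1)) \<le> card E"
    using greedy_deletion[OF sg, of 5] by auto
  let ?V = "V - D1" and ?E = "induced_edges E (V - D1)"
  note sg1 = simple_graph_deletion[OF sg D1(1)] and deg1 = degree_deletion[OF sg D1(1)]
  obtain D2 where D2: "deletion ?V ?E 4 D2" "14 * card D2 \<le> 5 * card ?V"
    using deletion_to_4[OF sg1 deg1] by blast
  obtain D3 where D3: "deletion ?V ?E 4 D3"
    "5 * card D3 + card (induced_edges ?E (?V - D3)) \<le> card ?E"
    using greedy_deletion[OF sg1, of 4] by auto
  \<comment> \<open>With weights 14 and 45 the coefficients of \<open>card D1\<close> cancel: 59 = 5
    + 9 * 6.\<close>
  have "59 * card D1 + 59 * card D2 \<le> 5 * card V + 9 * card E \<or>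
      59 * card D1 + 59 * card D3 \<le> 5 * card V + 9 * card E"
    using D1(2) D2(2) D3(2) card_deletion[OF sg D1(1)] by linarith
  moreover have "card (D1 \<union> D2) \<le> card D1 + card D2" "card (D1 \<union> D3) \<le> card D1 + card D3"
    by (rule card_Un_le)+
  ultimately have "59 * card (D1 \<union> D2) \<le> 5 * card V + 9 * card E \<or>
      59 * card (D1 \<union> D3) \<le> 5 * card V + 9 * card E" by linarith
  then show ?thesis using deletion_union[OF D1(1) D2(1)] deletion_union[OF D1(1) D3(1)] by blast
qed

section \<open>The six bounds for induced subgraphs of bounded degree\<close>

theorem theorem8:
  fixes V :: "'a set" and E :: "'a set set" and n m d k :: nat
  assumes "simple_graph V E"
    and "card V = n" and "n \<ge> 1"
    and "card E = m"
    and "max_degree V E = d" and "d \<ge> 4"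
    and "3 \<le> k" and "k \<le> d - 1"
  shows "\<exists>I \<subseteq> V. max_degree I (induced_edges E I) \<le> k \<and>
    (d = 4 \<and> k = 3 \<longrightarrow> real (card I) \<ge> 7/11 * real n - 24/11) \<and>
    (d = 5 \<and> k = 3 \<longrightarrow> real (card I) \<ge> 35/78 * real n - 8/13) \<and>
    (d \<ge> 6 \<and> k = 3 \<longrightarrow> real (card I) \<ge> 10/13 * real n - 5/39 * real m - 8/13) \<and>
    (d = 5 \<and> k = 4 \<longrightarrow> real (card I) \<ge> 9/14 * real n - 1/2) \<and>
    (d \<ge> 6 \<and> k = 4 \<longrightarrow> real (card I) \<ge> 54/59 * real n - 9/59 * real m - 35/59) \<and>
    (d \<ge> 6 \<and> k \<ge> 5 \<longrightarrow> real (card I) \<ge> real n - real m / (real k + 1))"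
proof -
  note sg = assms(1)
  have finV: "finite V" using sg by (simp add: simple_graph_def)
  have deg: "\<forall>v\<in>V. vertex_degree E v \<le> d"
    using max_degree_le_iff[OF finV, of E d] assms(5) by simp
  have hs: "2 * m \<le> d * n" using handshake[OF sg deg] assms by simp
  \<comment> \<open>These are bounds for the complement of the required set with denominators
    cleared. They have no additive constants and therefore imply the weaker bounds with such
    constants.\<close>
  have "\<exists>D. deletion V E k D \<and>
    (d = 4 \<and> k = 3 \<longrightarrow> 11 * card D \<le> 4 * n) \<and>
    (d \<ge> 5 \<and> k = 3 \<longrightarrow> 39 * card D \<le> 9 * n + 5 * m) \<and>
    (d = 5 \<and> k = 4 \<longrightarrow> 14 * card D \<le> 5 * n) \<and>
    (d \<ge> 6 \<and> k = 4 \<longrightarrow> 59 * card D \<le> 5 * n + 9 * m) \<and>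
    (k \<ge> 5 \<longrightarrow> Suc k * card D \<le> m)"
  proof -
    consider "k = 3" "d = 4" | "k = 3" "d \<ge> 5" | "k = 4" "d = 5" | "k = 4" "d \<ge> 6" | "k \<ge> 5"
      using assms(6-8) by linarith
    then show ?thesis
    proof cases
      case 1
      then show ?thesis using deletion_to_3[OF sg] deg assms(2) by auto
    next
      case 2
      then show ?thesis using deletion_any_to_3[OF sg] assms(2,4) by auto
    next
      case 3
      then show ?thesis using deletion_to_4[OF sg] deg assms(2) by auto
    next
      case 4
      then show ?thesis using deletion_any_to_4[OF sg] assms(2,4) by auto
    next
      case 5
      obtain D where "deletion V E k D"
        "Suc k * card D + card (induced_edges E (V - D)) \<le> card E"
        using greedy_deletion[OF sg] by blast
      then show ?thesis using 5 assms(4) by (intro exI[of _ D]) auto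
    qed
  qed
  then obtain D where D: "deletion V E k D"
    and D43: "d = 4 \<and> k = 3 \<Longrightarrow> 11 * card D \<le> 4 * n"
    and D3: "d \<ge> 5 \<and> k = 3 \<Longrightarrow> 39 * card D \<le> 9 * n + 5 * m"
    and D54: "d = 5 \<and> k = 4 \<Longrightarrow> 14 * card D \<le> 5 * n"
    and D4: "d \<ge> 6 \<and> k = 4 \<Longrightarrow> 59 * card D \<le> 5 * n + 9 * m"
    and D5: "k \<ge> 5 \<Longrightarrow> Suc k * card D \<le> m" by blast
  let ?I = "V - D"
  have I: "real (card ?I) = real n - real (card D)"
    using card_deletion[OF sg D] assms(2) by linarith
  show ?thesis
  proof (intro exI[of _ ?I] conjI impI)
    show "?I \<subseteq> V" by auto
    show "max_degree ?I (induced_edges E ?I) \<le> k"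
      using max_degree_le_iff[of ?I] degree_deletion[OF sg D] finV by auto
  next
    assume "d = 4 \<and> k = 3"
    then show "real (card ?I) \<ge> 7/11 * real n - 24/11" using D43 I by linarith
  next
    assume dk: "d = 5 \<and> k = 3"
    \<comment> \<open>The edge term is eliminated: 78 \<open>card D\<close> is at most 18
      \<open>n\<close> + 10 \<open>m\<close>, hence at most 18 \<open>n\<close> + 25
      \<open>n\<close> = 43 \<open>n\<close>.\<close>
    then have "2 * m \<le> 5 * n" using hs by simp
    then have "78 * card D \<le> 43 * n" using D3 dk by linarith
    then show "real (card ?I) \<ge> 35/78 * real n - 8/13" using I by linarith
  next
    assume "d \<ge> 6 \<and> k = 3"
    then have "39 * card D \<le> 9 * n + 5 * m" using D3 by simp
    then show "real (card ?I) \<ge> 10/13 * real n - 5/39 * real m - 8/13" using I by linarith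
  next
    assume "d = 5 \<and> k = 4"
    then show "real (card ?I) \<ge> 9/14 * real n - 1/2" using D54 I by linarith
  next
    assume "d \<ge> 6 \<and> k = 4"
    then show "real (card ?I) \<ge> 54/59 * real n - 9/59 * real m - 35/59" using D4 I by linarith
  next
    assume "d \<ge> 6 \<and> k \<ge> 5"
    then have "Suc k * card D \<le> m" using D5 by simp
    then have "real (Suc k * card D) \<le> real m" by (rule of_nat_mono)
    then have "real (card D) \<le> real m / (real k + 1)"
      by (simp add: pos_le_divide_eq algebra_simps)
    then show "real (card ?I) \<ge> real n - real m / (real k + 1)" using I by linarith
  qed
qed

end
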